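(* Assume the standing assumptions (a)–(d) below. Let $\bar\mu,\bar\mu'$ be probability measures on $\mathbb{R}^d$ with finite second moment. Let $T\in(0,\infty)$ and $\epsilon\in[0,\infty)$ satisfy $$LT^2\le \tfrac35\min\Big(\tfrac14,\ \tfrac{3}{256\cdot 5\,L\tilde R^2}\Big),\qquad \epsilon\tilde L\le \frac{5}{64}\,\frac{K}{\sqrt{7/6+3/(2KT^2)}}\exp\Big(-\frac{5\tilde R}{2T}-5\Big).$$ Let $(x,x')$ be any random pair with $x\sim\bar\mu$, $x'\sim\bar\mu'$, and let $\bar{\mathbf X}^{\bar\mu}(x,x')=\bar q_T(x,\xi,\bar\mu)$, $\bar{\mathbf X}'^{\bar\mu'}(x,x')=\bar q_T(x',\eta,\bar\mu')$ be the coupled nHMC transition described below. Then $$\mathbb{E}\big[\rho(\bar{\mathbf X}^{\bar\mu}(x,x'),\bar{\mathbf X}'^{\bar\mu'}(x,x'))\big]\le(1-c)\,\mathbb{E}[\rho(x,x')],\qquad c=\frac{KT^2}{156}\exp\Big(-\frac{5\tilde R}{4T}\Big).$$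
   Context: Standing assumptions: $V:\mathbb{R}^d\to\mathbb{R}$, $W:\mathbb{R}^d\times\mathbb{R}^d\to\mathbb{R}$ are $C^1$, $\nabla_1W$ is the gradient of $W$ in its first argument, and there are constants $L>0$, $K>0$, $\mathcal R\ge0$, $\tilde L\ge0$ with: (a) $V(0)=0$ and $V\ge0$; (b) $|\nabla V(x)-\nabla V(y)|\le L|x-y|$ for all $x,y$; (c) $\langle x-y,\nabla V(x)-\nabla V(y)\rangle\ge K|x-y|^2+L^{-1}|\nabla V(x)-\nabla V(y)|^2$ for all $x,y$ with $|x-y|\ge\mathcal R$; (d) $W(x,y)=W(y,x)$ and $|\nabla_1W(x,y)-\nabla_1W(\tilde x,\tilde y)|\le\tilde L(|x-\tilde x|+|y-\tilde y|)$ for all $x,y,\tilde x,\tilde y$. Constants: $\tilde R=\sqrt{(2L+K)/(6K)}\,\mathcal R$, $R_1=\frac54(\tilde R+2T)$, $\gamma=\min(T^{-1},\tilde R^{-1}/4)$ (with $1/0=\infty$). Metric: $f(r)=\int_0^r\exp(-\min(R_1,s)/T)\,\mathrm{d}s$ and $\rho(x,y)=f(|x-y|)$ on $\mathbb{R}^d$. Nonlinear dynamics: $U_\mu(x)=V(x)+\epsilon\int W(x,u)\mu(\mathrm{d}u)$; for $(x,v)\in\mathbb{R}^{2d}$ and a probability measure $\bar\mu$, $(\bar q_t,\bar p_t)(x,v,\bar\mu)$ solves $\dot{\bar q}_t=\bar p_t$, $\dot{\bar p}_t=-\nabla V(\bar q_t)-\epsilon\int\nabla_1W(\bar q_t,u)\bar\mu_t(\mathrm{d}u)$,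 $(\bar q_0,\bar p_0)=(x,v)$, with $\bar\mu_t=\mathrm{Law}(\bar q_t(\tilde x,\tilde v,\bar\mu))$, $(\tilde x,\tilde v)\sim\bar\mu\otimes\mathcal N(0,I_d)$. Coupling: given $(x,x')$, let $\xi\sim\mathcal N(0,I_d)$ and $\mathcal U\sim\mathrm{Unif}[0,1]$ be independent of each other and of $(x,x')$; put $z=x-x'$, $e=z/|z|$ if $z\ne0$ (else an arbitrary unit vector), $\varphi_{0,1}$ the standard normal density. If $|z|\ge\tilde R$, $\eta=\xi$; otherwise $\eta=\xi+\gamma z$ if $\mathcal U\le\varphi_{0,1}(e\cdot\xi+\gamma|z|)/\varphi_{0,1}(e\cdot\xi)$ and $\eta=\xi-2(e\cdot\xi)e$ else. (Then $\eta\sim\mathcal N(0,I_d)$.) *)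

theory Defs
  imports "HOL-Analysis.Analysis" "HOL-Probability.Probability"
begin

definition std_normal_vec :: "'a::euclidean_space measure" where
  "std_normal_vec = density lborel
     (\<lambda>x. ennreal ((2 * pi) powr (- real DIM('a) / 2) * exp (- (norm x)\<^sup>2 / 2)))"

definition unif01 :: "real measure" where
  "unif01 = uniform_measure lborel {0..1}"

definition Rtil :: "real \<Rightarrow> real \<Rightarrow> real \<Rightarrow> real" where
  "Rtil L K Rc = sqrt ((2 * L + K) / (6 * K)) * Rc"

definition R1 :: "real \<Rightarrow> real \<Rightarrow> real" where
  "R1 Rt T = 5 / 4 * (Rt + 2 * T)"

text \<open>gamma = min(1/T, 1/(4 R tilde)) with the convention 1/0 = infinity.\<close>
definition gam :: "real \<Rightarrow> real \<Rightarrow> real" where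
  "gam Rt T = (if Rt = 0 then 1 / T else min (1 / T) (1 / (4 * Rt)))"

text \<open>min(1/4, 3/(256*5*L*Rtil^2)) with the convention 1/0 = infinity.\<close>
definition LT_bound :: "real \<Rightarrow> real \<Rightarrow> real" where
  "LT_bound L Rt = (if Rt = 0 then 1 / 4 else min (1 / 4) (3 / (256 * 5 * L * Rt\<^sup>2)))"

definition fdist :: "real \<Rightarrow> real \<Rightarrow> real \<Rightarrow> real" where
  "fdist R1v T r = integral {0..r} (\<lambda>s. exp (- min R1v s / T))"

definition rho :: "real \<Rightarrow> real \<Rightarrow> 'a::euclidean_space \<Rightarrow> 'a \<Rightarrow> real" where
  "rho R1v T x y = fdist R1v T (norm (x - y))"

definition coup_eta :: "real \<Rightarrow> real \<Rightarrow> 'a::euclidean_space \<Rightarrow> 'a \<Rightarrow> 'a \<Rightarrow> real \<Rightarrow> 'a" where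
  "coup_eta Rt g x x' xi u =
     (let z = x - x';
          e = (if z \<noteq> 0 then (1 / norm z) *\<^sub>R z else (SOME b. b \<in> (Basis :: 'a set)))
      in if norm z \<ge> Rt then xi
         else if u \<le> std_normal_density (e \<bullet> xi + g * norm z) / std_normal_density (e \<bullet> xi)
              then xi + g *\<^sub>R z
              else xi - (2 * (e \<bullet> xi)) *\<^sub>R e)"

definition mf_law :: "'a::euclidean_space measure \<Rightarrow> (real \<Rightarrow> 'a \<Rightarrow> 'a \<Rightarrow> 'a) \<Rightarrow> real \<Rightarrow> 'a measure" where
  "mf_law mu Q t = distr (mu \<Otimes>\<^sub>M std_normal_vec) borel (\<lambda>(x, v). Q t x v)"

definition mf_flow :: "('a::euclidean_space \<Rightarrow> 'a) \<Rightarrow> ('a \<Rightarrow> 'a \<Rightarrow> 'a) \<Rightarrow> real \<Rightarrow> real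
    \<Rightarrow> 'a measure \<Rightarrow> (real \<Rightarrow> 'a \<Rightarrow> 'a \<Rightarrow> 'a) \<Rightarrow> (real \<Rightarrow> 'a \<Rightarrow> 'a \<Rightarrow> 'a) \<Rightarrow> bool" where
  "mf_flow gradV grad1W eps T mu Q P \<longleftrightarrow>
     (\<forall>t\<in>{0..T}. (\<lambda>(x, v). Q t x v) \<in> borel_measurable (mu \<Otimes>\<^sub>M std_normal_vec)) \<and>
     (\<forall>x v. Q 0 x v = x \<and> P 0 x v = v \<and>
       (\<forall>t\<in>{0..T}.
          integrable (mf_law mu Q t) (grad1W (Q t x v)) \<and>
          ((\<lambda>s. Q s x v) has_vector_derivative P t x v) (at t within {0..T}) \<and>
          ((\<lambda>s. P s x v) has_vector_derivative
              (- gradV (Q t x v) - eps *\<^sub>R (\<integral>u. grad1W (Q t x v) u \<partial>(mf_law mu Q t))))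
            (at t within {0..T})))"

end

theory Submission
  imports Defs
begin

text \<open>
  The difference \<open>z\<close> of two coupled trajectories solves \<open>z'' = - D - h\<close> with \<open>D\<close> the difference of the
  gradients of \<open>V\<close> and \<open>|h| \<le> \<epsilon> L\<^sub>W (|z| + A)\<close>, where \<open>A\<close> bounds the mean distance of the two laws. Since
  only the laws enter, \<open>A\<close> can be estimated with synchronised velocities, which gives \<open>A \<le> (6/5) E|x - x'|\<close>
  and makes it unnecessary to know that \<open>\<eta>\<close> is Gaussian.
  For distant initial points co-coercivity contracts \<open>|z|\<close>, because \<open>z\<close> stays in the convex region
  unless the mean-field term already dominates \<open>|x - x'|\<close>. For close points acceptance contracts \<open>|z|\<close> by
  \<open>1 - \<gamma> T\<close> up to small errors, while rejection has probability at most
  \<open>E[(a G + a\<^sup>2/2)\<^sup>+]\<close> for \<open>a = \<gamma> |x - x'| \<le> 1/4\<close> and \<open>G\<close> standard normal; there the concavity of \<open>f\<close> limits the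
  loss to about \<open>T f'(|x - x'|)\<close>. Finally \<open>exp(- R\<^sub>1/T) r \<le> f(r) \<le> r\<close> absorbs the mean-field error.
\<close>

section \<open>Second-order differential inequalities\<close>

text \<open>Two regularity questions shape the argument. No continuity in time of the mean-field
  force is available, so the Taylor remainder is written with the gauge integral, which integrates
  every derivative. The coupled endpoint, with its branching velocity, is never shown to be jointly
  measurable: for an arbitrary nonnegative integrand the integral over a product is at most the
  iterated one, and the iterated integral meets only pointwise bounds. The constants share one
  budget. Co-coercivity with Cauchy--Schwarz forces \<open>4 * K \<le> L\<close>, and the bound on
  \<open>L * T\<^sup>2\<close> yields \<open>L * T\<^sup>2 \<le> 3 / 20 * (\<gamma> * T)\<close>;
  hence the gain for close points, 9/50 of \<gamma> T, dominates the gain for distant points, 9/25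
  of \<open>K * T\<^sup>2\<close>. The slope of f never falls below exp (- R1 / T), which is exp (-
  5 / 2) times the exponential in the rate c. The bound on \<epsilon> carries the square of this
  minimal slope: one factor pays for comparing the mean of |x - x'| with the mean of \<rho>, the
  other brings the mean-field error to the scale of the contraction.\<close>

lemma second_order_remainder_integral:
  fixes z w a :: "real \<Rightarrow> 'a::euclidean_space"
  assumes z: "\<And>s. s \<in> {0..T} \<Longrightarrow> (z has_vector_derivative w s) (at s within {0..T})"
    and w: "\<And>s. s \<in> {0..T} \<Longrightarrow> (w has_vector_derivative a s) (at s within {0..T})"
    and t: "t \<in> {0..T}"
  shows "((\<lambda>s. (t - s) *\<^sub>R a s) has_integral z t - z 0 - t *\<^sub>R w 0) {0..t}"
proof -
  \<comment> \<open>The integrand is the derivative of \<open>(t - s) *\<^sub>R w s + z s\<close>,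
    because the two terms containing \<open>w s\<close> cancel.\<close>
  have "((\<lambda>s. (t - s) *\<^sub>R a s) has_integral
      ((t - t) *\<^sub>R w t + z t) - ((t - 0) *\<^sub>R w 0 + z 0)) {0..t}"
  proof (rule fundamental_theorem_of_calculus)
    show "0 \<le> t" using t by simp
    fix s assume s: "s \<in> {0..t}"
    then have zs: "(z has_vector_derivative w s) (at s within {0..t})"
      and ws: "(w has_vector_derivative a s) (at s within {0..t})"
      using z[of s] w[of s] t by (auto intro: has_vector_derivative_within_subset)
    have "((\<lambda>s. (t - s) *\<^sub>R w s + z s) has_vector_derivative
        ((t - s) *\<^sub>R a s + (- 1) *\<^sub>R w s) + w s) (at s within {0..t})"
      by (intro has_vector_derivative_add has_vector_derivative_scaleR zs ws)
         (auto intro!: derivative_eq_intros)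
    then show "((\<lambda>s. (t - s) *\<^sub>R w s + z s) has_vector_derivative (t - s) *\<^sub>R a s)
        (at s within {0..t})" by simp
  qed
  then show ?thesis by (simp add: algebra_simps)
qed

lemma has_integral_triangle:
  assumes "0 \<le> (t::real)"
  shows "((\<lambda>s. (t - s) * c) has_integral c * t\<^sup>2 / 2) {0..t}"
proof -
  have "((\<lambda>s. (t - s) * c) has_integral (- (t - t)\<^sup>2 / 2 * c) - (- (t - 0)\<^sup>2 / 2 * c)) {0..t}"
    by (rule fundamental_theorem_of_calculus[OF assms])
       (auto intro!: derivative_eq_intros simp: has_real_derivative_iff_has_vector_derivative[symmetric] field_simps)
  then show ?thesis by (simp add: algebra_simps)
qed

lemma has_integral_norm_le:
  fixes f :: "real \<Rightarrow> 'a::euclidean_space"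
  assumes f: "(f has_integral i) S" and g: "(g has_integral j) S"
    and le: "\<And>x. x \<in> S \<Longrightarrow> norm (f x) \<le> g x"
  shows "norm i \<le> j"
  using integral_norm_bound_integral[of f S g] f g le
  by (metis has_integral_integrable has_integral_integrable_integral)

lemma second_order_remainder_bound:
  fixes z w a :: "real \<Rightarrow> 'a::euclidean_space"
  assumes z: "\<And>s. s \<in> {0..T} \<Longrightarrow> (z has_vector_derivative w s) (at s within {0..T})"
    and w: "\<And>s. s \<in> {0..T} \<Longrightarrow> (w has_vector_derivative a s) (at s within {0..T})"
    and B: "\<And>s. s \<in> {0..T} \<Longrightarrow> norm (a s) \<le> B"
    and t: "t \<in> {0..T}"
  shows "norm (z t - z 0 - t *\<^sub>R w 0) \<le> B * t\<^sup>2 / 2"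
proof (rule has_integral_norm_le[OF second_order_remainder_integral[OF z w t] has_integral_triangle])
  fix s assume "s \<in> {0..t}"
  then show "norm ((t - s) *\<^sub>R a s) \<le> (t - s) * B"
    using B[of s] t by (auto intro!: mult_left_mono)
qed (use t in auto)

text \<open>A maximum argument in place of Gronwall: where \<open>norm (z s)\<close> attains its
  maximum M, the Taylor remainder is at most 2/25 M + \<open>h * T\<^sup>2 / 2\<close>, so M can be
  absorbed, and 25/23 \<le> 11/10. The threshold 4/25 leaves 1/100 above the bound 3/20 on
  \<open>L * T\<^sup>2\<close> for the mean-field part.\<close>

lemma second_order_growth:
  fixes z w a :: "real \<Rightarrow> 'a::euclidean_space"
  assumes z: "\<And>s. s \<in> {0..T} \<Longrightarrow> (z has_vector_derivative w s) (at s within {0..T})"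
    and w: "\<And>s. s \<in> {0..T} \<Longrightarrow> (w has_vector_derivative a s) (at s within {0..T})"
    and B: "\<And>s. s \<in> {0..T} \<Longrightarrow> norm (a s) \<le> C * norm (z s) + h"
    and m: "\<And>s. s \<in> {0..T} \<Longrightarrow> norm (z 0 + s *\<^sub>R w 0) \<le> m"
    and C: "0 \<le> C" "C * T\<^sup>2 \<le> 4 / 25" and h: "0 \<le> h"
    and t: "t \<in> {0..T}"
  shows "norm (z t) \<le> 11 / 10 * (m + h * T\<^sup>2 / 2)"
proof -
  have "continuous_on {0..T} (\<lambda>s. norm (z s))"
    by (rule continuous_on_norm[OF continuous_on_vector_derivative[OF z]])
  from continuous_attains_sup[OF compact_Icc _ this] t
  obtain s0 where s0: "s0 \<in> {0..T}" and mx: "\<And>s. s \<in> {0..T} \<Longrightarrow> norm (z s) \<le> norm (z s0)"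
    by auto
  define M where "M = norm (z s0)"
  have M0: "0 \<le> M" by (simp add: M_def)
  have "norm (a s) \<le> C * M + h" if "s \<in> {0..T}" for s
    using B[OF that] mult_left_mono[OF mx[OF that] C(1)] by (simp add: M_def)
  then have "norm (z s0 - z 0 - s0 *\<^sub>R w 0) \<le> (C * M + h) * s0\<^sup>2 / 2"
    by (intro second_order_remainder_bound[OF z w _ s0]) auto
  also have "\<dots> \<le> (C * M + h) * T\<^sup>2 / 2"
    using s0 C h M0 by (intro divide_right_mono mult_left_mono power_mono) auto
  finally have "norm (z s0 - z 0 - s0 *\<^sub>R w 0) \<le> (C * T\<^sup>2) * M / 2 + h * T\<^sup>2 / 2"
    by (simp add: algebra_simps)
  also have "\<dots> \<le> 4 / 25 * M / 2 + h * T\<^sup>2 / 2"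
    using mult_right_mono[OF C(2) M0] by simp
  finally have "norm (z s0 - z 0 - s0 *\<^sub>R w 0) \<le> 2 / 25 * M + h * T\<^sup>2 / 2" by simp
  moreover have "M \<le> norm (z 0 + s0 *\<^sub>R w 0) + norm (z s0 - z 0 - s0 *\<^sub>R w 0)"
    unfolding M_def using norm_triangle_ineq[of "z 0 + s0 *\<^sub>R w 0" "z s0 - z 0 - s0 *\<^sub>R w 0"] by simp
  ultimately have "23 / 25 * M \<le> m + h * T\<^sup>2 / 2" using m[OF s0] by linarith
  then have "M \<le> 25 / 23 * (m + h * T\<^sup>2 / 2)" by simp
  also have "\<dots> \<le> 11 / 10 * (m + h * T\<^sup>2 / 2)"
    using \<open>23 / 25 * M \<le> _\<close> M0 by (intro mult_right_mono) auto
  finally show ?thesis using mx[OF t] by (simp add: M_def)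
qed

text \<open>Only the scalar \<open>\<sigma> = \<integral> (T - s) |D s| ds\<close> is needed: the dissipation \<open>|D|\<^sup>2 / L\<close> is bounded below
  by its tangent line at \<open>2 \<sigma> / T\<^sup>2\<close>, which replaces a Cauchy--Schwarz estimate.\<close>

lemma second_order_far_contraction:
  fixes z w D h :: "real \<Rightarrow> 'a::euclidean_space"
  assumes z: "\<And>s. s \<in> {0..T} \<Longrightarrow> (z has_vector_derivative w s) (at s within {0..T})"
    and w: "\<And>s. s \<in> {0..T} \<Longrightarrow> (w has_vector_derivative - D s - h s) (at s within {0..T})"
    and w0: "w 0 = 0"
    and Dc: "continuous_on {0..T} D"
    and D: "\<And>s. s \<in> {0..T} \<Longrightarrow> norm (D s) \<le> L * norm (z s)"
    and conv: "\<And>s. s \<in> {0..T} \<Longrightarrow> norm (z s) \<ge> Rc \<Longrightarrow>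
       z s \<bullet> D s \<ge> K * (norm (z s))\<^sup>2 + (norm (D s))\<^sup>2 / L"
    and h: "\<And>s. s \<in> {0..T} \<Longrightarrow> norm (h s) \<le> H"
    and M: "\<And>s. s \<in> {0..T} \<Longrightarrow> norm (z s) \<le> 1155 / 1000 * norm (z 0)"
    and far: "(norm (z 0))\<^sup>2 \<ge> 3 / 2 * Rc\<^sup>2"
    and T: "T > 0" and L: "L > 0" "L * T\<^sup>2 \<le> 3 / 20" and K: "K > 0" "4 * K \<le> L"
    and H: "H * T\<^sup>2 \<le> norm (z 0) / 10"
  shows "norm (z T) \<le> (1 - 37 / 100 * K * T\<^sup>2) * norm (z 0) + 51 / 100 * (H * T\<^sup>2)"
proof -
  define r where "r = norm (z 0)"
  have r0: "r \<ge> 0" by (simp add: r_def)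
  have H0: "H \<ge> 0" using order_trans[OF norm_ge_zero h[of 0]] T by simp
  have zc: "continuous_on {0..T} z"
    by (rule continuous_on_vector_derivative[OF z])
  have a_bd: "norm (- D s - h s) \<le> L * (1155 / 1000 * r) + H" if "s \<in> {0..T}" for s
  proof -
    have "norm (- D s - h s) \<le> norm (D s) + norm (h s)"
      using norm_triangle_ineq4[of "- D s" "h s"] by simp
    moreover have "L * norm (z s) \<le> L * (1155 / 1000 * r)"
      using M[OF that] L by (simp add: r_def)
    ultimately show ?thesis using D[OF that] h[OF that] by linarith
  qed
  \<comment> \<open>A crude displacement bound: 3/20 * 1155/2000 + 1/20 < 137/1000. It keeps
    \<open>norm (z s)\<close> above 863/1000 of its initial value, and since (863/1000)^2 > 2/3 the
    hypothesis \<open>far\<close> then keeps the whole trajectory beyond \<open>Rc\<close>.\<close>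
  have dev0: "norm (z s - z 0) \<le> 137 / 1000 * r" if s: "s \<in> {0..T}" for s
  proof -
    have "norm (z s - z 0) \<le> (L * (1155 / 1000 * r) + H) * s\<^sup>2 / 2"
      using second_order_remainder_bound[OF z w a_bd s] w0 by simp
    also have "\<dots> \<le> (L * (1155 / 1000 * r) + H) * T\<^sup>2 / 2"
      using s L H0 r0 by (intro divide_right_mono mult_left_mono power_mono) auto
    also have "\<dots> = (L * T\<^sup>2) * (1155 / 2000 * r) + H * T\<^sup>2 / 2" by (simp add: algebra_simps)
    also have "\<dots> \<le> 3 / 20 * (1155 / 2000 * r) + r / 10 / 2"
      using L H r0 by (intro add_mono mult_right_mono) (auto simp: r_def)
    also have "\<dots> \<le> 137 / 1000 * r" using r0 by simp
    finally show ?thesis .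
  qed
  have low: "norm (z s) \<ge> 863 / 1000 * r" if s: "s \<in> {0..T}" for s
    using dev0[OF s] norm_triangle_ineq2[of "z 0" "z s"] by (simp add: r_def norm_minus_commute)
  have Rc: "norm (z s) \<ge> Rc" if s: "s \<in> {0..T}" for s
  proof (rule power2_le_imp_le)
    have "Rc\<^sup>2 \<le> 2 / 3 * r\<^sup>2" using far by (simp add: r_def)
    also have "\<dots> \<le> (863 / 1000 * r)\<^sup>2" by (simp add: power_mult_distrib power2_eq_square)
    also have "\<dots> \<le> (norm (z s))\<^sup>2" using low[OF s] r0 by (intro power_mono) auto
    finally show "Rc\<^sup>2 \<le> (norm (z s))\<^sup>2" .
  qed auto
  define S where "S = integral {0..T} (\<lambda>s. (T - s) *\<^sub>R D s)"
  define \<sigma> where "\<sigma> = integral {0..T} (\<lambda>s. (T - s) * norm (D s))"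
  have S: "((\<lambda>s. (T - s) *\<^sub>R D s) has_integral S) {0..T}"
    unfolding S_def by (intro integrable_integral integrable_continuous_real continuous_intros Dc)
  have \<sigma>: "((\<lambda>s. (T - s) * norm (D s)) has_integral \<sigma>) {0..T}"
    unfolding \<sigma>_def by (intro integrable_integral integrable_continuous_real continuous_intros Dc)
  have \<sigma>0: "\<sigma> \<ge> 0" using \<sigma> by (rule has_integral_nonneg) auto
  have S_le: "norm S \<le> \<sigma>" by (rule has_integral_norm_le[OF S \<sigma>]) auto
  \<comment> \<open>A second bound on the same displacement, now through \<open>\<sigma>\<close>.
    The error it causes in \<open>z 0 \<bullet> S\<close> is quadratic in \<open>\<sigma>\<close> up
    to the perturbation and can be paid by the dissipation, whereas \<open>dev0\<close> would leave
    a term of order r \<sigma>.\<close>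
  have dev: "norm (z s - z 0) \<le> \<sigma> + H * T\<^sup>2 / 2" if s: "s \<in> {0..T}" for s
  proof -
    have i: "((\<lambda>u. (s - u) *\<^sub>R (- D u - h u)) has_integral z s - z 0) {0..s}"
      using second_order_remainder_integral[OF z w s] w0 by simp
    have ci: "(\<lambda>u. (s - u) * norm (D u)) integrable_on {0..s}"
      using s by (intro integrable_continuous_real continuous_intros continuous_on_subset[OF Dc]) auto
    have j: "((\<lambda>u. (s - u) * norm (D u) + (s - u) * H) has_integral
        integral {0..s} (\<lambda>u. (s - u) * norm (D u)) + H * s\<^sup>2 / 2) {0..s}"
      using s by (intro has_integral_add integrable_integral ci has_integral_triangle) auto
    have "norm (z s - z 0) \<le> integral {0..s} (\<lambda>u. (s - u) * norm (D u)) + H * s\<^sup>2 / 2"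
    proof (rule has_integral_norm_le[OF i j])
      fix u assume u: "u \<in> {0..s}"
      have "norm (- D u - h u) \<le> norm (D u) + H"
        using norm_triangle_ineq4[of "- D u" "h u"] h[of u] u s by auto
      then have "(s - u) * norm (- D u - h u) \<le> (s - u) * (norm (D u) + H)"
        using u by (intro mult_left_mono) auto
      then show "norm ((s - u) *\<^sub>R (- D u - h u)) \<le> (s - u) * norm (D u) + (s - u) * H"
        using u by (simp add: distrib_left)
    qed
    moreover have "integral {0..s} (\<lambda>u. (s - u) * norm (D u)) \<le> integral {0..s} (\<lambda>u. (T - u) * norm (D u))"
      using s by (intro integral_le ci integrable_continuous_real continuous_intros
          continuous_on_subset[OF Dc] mult_right_mono) auto
    moreover have "integral {0..s} (\<lambda>u. (T - u) * norm (D u)) \<le> \<sigma>"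
      unfolding \<sigma>_def using s
      by (intro integral_subset_le integrable_continuous_real continuous_intros
          continuous_on_subset[OF Dc]) auto
    moreover have "H * s\<^sup>2 \<le> H * T\<^sup>2" using s H0 by (intro mult_left_mono power_mono) auto
    ultimately show ?thesis by linarith
  qed
  \<comment> \<open>This is the mean of \<open>norm (D s)\<close> under the weight
    \<open>T - s\<close> of total mass \<open>T\<^sup>2 / 2\<close>; at this point the integrated
    tangent bound loses nothing against Jensen's inequality.\<close>
  define \<beta> where "\<beta> = 2 * \<sigma> / T\<^sup>2"
  define c1 where "c1 = 2 * \<beta> / L - \<sigma> - H * T\<^sup>2 / 2"
  define c2 where "c2 = K * (863 / 1000 * r)\<^sup>2 - \<beta>\<^sup>2 / L"
  have pw: "z 0 \<bullet> D s \<ge> c1 * norm (D s) + c2" if s: "s \<in> {0..T}" for s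
  proof -
    have "z 0 \<bullet> D s = z s \<bullet> D s - (z s - z 0) \<bullet> D s" by (simp add: inner_diff_left)
    moreover have "(z s - z 0) \<bullet> D s \<le> (\<sigma> + H * T\<^sup>2 / 2) * norm (D s)"
      using norm_cauchy_schwarz[of "z s - z 0" "D s"] mult_right_mono[OF dev[OF s], of "norm (D s)"]
      by simp
    moreover have "K * (863 / 1000 * r)\<^sup>2 \<le> K * (norm (z s))\<^sup>2"
      using low[OF s] r0 K by (intro mult_left_mono power_mono) auto
    moreover have "(norm (D s))\<^sup>2 / L \<ge> (2 * \<beta> * norm (D s) - \<beta>\<^sup>2) / L"
    proof (rule divide_right_mono)
      show "2 * \<beta> * norm (D s) - \<beta>\<^sup>2 \<le> (norm (D s))\<^sup>2"
        using zero_le_power2[of "norm (D s) - \<beta>"] by (simp add: power2_diff algebra_simps)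
    qed (use L in auto)
    ultimately show ?thesis using conv[OF s Rc[OF s]]
      by (simp add: c1_def c2_def algebra_simps diff_divide_distrib)
  qed
  have zS: "z 0 \<bullet> S \<ge> c1 * \<sigma> + c2 * T\<^sup>2 / 2"
  proof (rule has_integral_le)
    show "((\<lambda>s. c1 * ((T - s) * norm (D s)) + (T - s) * c2) has_integral c1 * \<sigma> + c2 * T\<^sup>2 / 2) {0..T}"
      using T by (intro has_integral_add has_integral_mult_right \<sigma> has_integral_triangle) auto
    show "((\<lambda>s. z 0 \<bullet> ((T - s) *\<^sub>R D s)) has_integral z 0 \<bullet> S) {0..T}"
      using has_integral_linear[OF S bounded_linear_inner_right[of "z 0"]] by (simp add: o_def)
    fix s assume s: "s \<in> {0..T}"
    then have "(T - s) * (c1 * norm (D s) + c2) \<le> (T - s) * (z 0 \<bullet> D s)"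
      using pw[OF s] by (intro mult_left_mono) auto
    then show "c1 * ((T - s) * norm (D s)) + (T - s) * c2 \<le> z 0 \<bullet> ((T - s) *\<^sub>R D s)"
      by (simp add: algebra_simps)
  qed
  have t1: "\<sigma>\<^sup>2 / (L * T\<^sup>2) \<ge> 20 / 3 * \<sigma>\<^sup>2"
  proof -
    have "20 / 3 * \<sigma>\<^sup>2 * (L * T\<^sup>2) \<le> 20 / 3 * \<sigma>\<^sup>2 * (3 / 20)"
      using L by (intro mult_left_mono) auto
    then show ?thesis using L T by (subst pos_le_divide_eq) auto
  qed
  have "c1 * \<sigma> + c2 * T\<^sup>2 / 2
      = 2 * (\<sigma>\<^sup>2 / (L * T\<^sup>2)) - \<sigma>\<^sup>2 - \<sigma> * (H * T\<^sup>2) / 2 + K * T\<^sup>2 * (863 / 1000)\<^sup>2 / 2 * r\<^sup>2"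
  proof -
    have "2 * \<beta> / L * \<sigma> = 4 * (\<sigma>\<^sup>2 / (L * T\<^sup>2))"
      by (simp add: \<beta>_def power2_eq_square mult_ac)
    moreover have "\<beta>\<^sup>2 / L * T\<^sup>2 / 2 = 2 * (\<sigma>\<^sup>2 / (L * T\<^sup>2))"
      using T by (simp add: \<beta>_def power_divide power_mult_distrib power2_eq_square mult_ac)
    moreover have "c1 * \<sigma> + c2 * T\<^sup>2 / 2 = 2 * \<beta> / L * \<sigma> - \<sigma>\<^sup>2 - \<sigma> * (H * T\<^sup>2) / 2
        + K * T\<^sup>2 * (863 / 1000)\<^sup>2 / 2 * r\<^sup>2 - \<beta>\<^sup>2 / L * T\<^sup>2 / 2"
      unfolding c1_def c2_def power_mult_distrib
      by (simp add: algebra_simps add_divide_distrib diff_divide_distrib power2_eq_square[of \<sigma>])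
    ultimately show ?thesis by linarith
  qed
  \<comment> \<open>As \<open>L * T\<^sup>2 \<le> 3 / 20\<close>, the dissipation contributes at
    least 40/3 \<sigma>^2. The displacement costs \<sigma>^2, so more than 12 \<sigma>^2 survives.
    The number 372/1000 is (863/1000)^2 / 2 rounded down.\<close>
  with zS t1 have zS': "z 0 \<bullet> S \<ge> 12 * \<sigma>\<^sup>2 - \<sigma> * (H * T\<^sup>2) / 2 + 372 / 1000 * (K * T\<^sup>2 * r\<^sup>2)"
  proof -
    have "K * T\<^sup>2 * r\<^sup>2 \<ge> 0" using K by auto
    then have "372 / 1000 * (K * T\<^sup>2 * r\<^sup>2) \<le> K * T\<^sup>2 * (863 / 1000)\<^sup>2 / 2 * r\<^sup>2"
      by (simp add: power2_eq_square)
    moreover have "\<sigma>\<^sup>2 \<ge> 0" by simp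
    ultimately show ?thesis using zS t1 \<open>c1 * \<sigma> + c2 * T\<^sup>2 / 2 = _\<close> by linarith
  qed
  define b where "b = H * T\<^sup>2 / 100"
  define \<kappa> where "\<kappa> = 37 / 100 * K * T\<^sup>2"
  have \<kappa>1: "0 \<le> \<kappa>" "\<kappa> \<le> 1"
  proof -
    have "4 * K * T\<^sup>2 \<le> L * T\<^sup>2" using K by (intro mult_right_mono) auto
    then show "\<kappa> \<le> 1" using L by (simp add: \<kappa>_def)
    show "0 \<le> \<kappa>" using K by (simp add: \<kappa>_def)
  qed
  have b0: "b \<ge> 0" using H0 by (simp add: b_def)
  \<comment> \<open>Squaring makes \<open>z 0 \<bullet> S\<close> appear. Of the available 24
    \<sigma>^2 one is spent on |S|^2; the other 23 absorb the term linear in \<sigma> at the cost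
    \<open>(H * T\<^sup>2)\<^sup>2 / 92\<close>, which \<open>b\<close> covers because
    \<open>H * T\<^sup>2 \<le> r / 10\<close>. What the squared right side has in excess is
    \<open>(\<kappa> * r - b)\<^sup>2\<close>.\<close>
  have "norm (z 0 - S) \<le> (1 - \<kappa>) * r + b"
  proof (rule power2_le_imp_le)
    have "(norm (z 0 - S))\<^sup>2 = r\<^sup>2 - 2 * (z 0 \<bullet> S) + (norm S)\<^sup>2"
      by (simp add: power2_norm_eq_inner r_def inner_diff inner_commute algebra_simps)
    also have "(norm S)\<^sup>2 \<le> \<sigma>\<^sup>2" using S_le by (intro power_mono) auto
    also have "r\<^sup>2 - 2 * (z 0 \<bullet> S) + \<sigma>\<^sup>2
        \<le> r\<^sup>2 - 2 * \<kappa> * r\<^sup>2 - 23 * \<sigma>\<^sup>2 + \<sigma> * (H * T\<^sup>2)"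
    proof -
      have "K * T\<^sup>2 * r\<^sup>2 \<ge> 0" using K by auto
      then show ?thesis using zS' by (simp add: \<kappa>_def)
    qed
    also have "\<dots> \<le> r\<^sup>2 - 2 * \<kappa> * r\<^sup>2 + (H * T\<^sup>2)\<^sup>2 / 92"
    proof -
      have "0 \<le> 23 * (\<sigma> - H * T\<^sup>2 / 46)\<^sup>2" by simp
      also have "\<dots> = 23 * \<sigma>\<^sup>2 - \<sigma> * (H * T\<^sup>2) + (H * T\<^sup>2)\<^sup>2 / 92"
        by (simp add: power2_diff power2_eq_square algebra_simps)
      finally show ?thesis by simp
    qed
    also have "(H * T\<^sup>2)\<^sup>2 / 92 \<le> 2 * r * b"
    proof -
      have "(H * T\<^sup>2) * (H * T\<^sup>2) \<le> (r / 10) * (H * T\<^sup>2)"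
        using H H0 by (intro mult_right_mono) (auto simp: r_def)
      moreover have "r * (H * T\<^sup>2) \<ge> 0" using r0 H0 by auto
      ultimately show ?thesis by (simp add: b_def power2_eq_square algebra_simps)
    qed
    also have "r\<^sup>2 - 2 * \<kappa> * r\<^sup>2 + 2 * r * b \<le> ((1 - \<kappa>) * r + b)\<^sup>2"
      using zero_le_power2[of "\<kappa> * r - b"] by (simp add: power2_eq_square algebra_simps)
    finally show "(norm (z 0 - S))\<^sup>2 \<le> ((1 - \<kappa>) * r + b)\<^sup>2" by simp
    show "0 \<le> (1 - \<kappa>) * r + b" using \<kappa>1 r0 b0 by auto
  qed
  moreover have "norm (z T - z 0 + S) \<le> H * T\<^sup>2 / 2"
  proof (rule has_integral_norm_le)
    show "((\<lambda>s. (T - s) *\<^sub>R (- D s - h s) + (T - s) *\<^sub>R D s) has_integral z T - z 0 + S) {0..T}"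
      using second_order_remainder_integral[OF z w, of T] w0 T by (intro has_integral_add S) simp
    show "((\<lambda>s. (T - s) * H) has_integral H * T\<^sup>2 / 2) {0..T}"
      using T by (intro has_integral_triangle) auto
    fix s assume s: "s \<in> {0..T}"
    have "(T - s) *\<^sub>R (- D s - h s) + (T - s) *\<^sub>R D s = - ((T - s) *\<^sub>R h s)"
      by (simp add: algebra_simps)
    then show "norm ((T - s) *\<^sub>R (- D s - h s) + (T - s) *\<^sub>R D s) \<le> (T - s) * H"
      using s h[OF s] by (auto intro!: mult_left_mono)
  qed
  moreover have "norm (z T) \<le> norm (z 0 - S) + norm (z T - z 0 + S)"
    using norm_triangle_ineq[of "z 0 - S" "z T - z 0 + S"] by simp
  ultimately have "norm (z T) \<le> (1 - \<kappa>) * r + b + H * T\<^sup>2 / 2" by linarith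
  also have "\<dots> = (1 - \<kappa>) * r + 51 / 100 * (H * T\<^sup>2)" by (simp add: b_def)
  finally show ?thesis by (simp only: \<kappa>_def r_def)
qed

section \<open>The concave distance\<close>

lemma fdist_has_integral:
  assumes "0 \<le> a" "a \<le> b"
  shows "((\<lambda>s. exp (- min R s / T)) has_integral fdist R T b - fdist R T a) {a..b}"
proof -
  have i: "(\<lambda>s. exp (- min R s / T)) integrable_on {c..d}" for c d
    unfolding divide_inverse by (intro integrable_continuous_real continuous_intros)
  have "fdist R T a + integral {a..b} (\<lambda>s. exp (- min R s / T)) = fdist R T b"
    unfolding fdist_def by (rule Henstock_Kurzweil_Integration.integral_combine[OF assms i])
  with i[of a b] show ?thesis by (metis add_diff_cancel_left' integrable_integral)
qed

text \<open>The integrand is nonincreasing, so the tangent at \<open>r\<close> lies above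
  \<open>fdist\<close> on both sides. Taking \<open>r' < r\<close> turns a contraction into a gain,
  \<open>r' > r\<close> bounds a loss, and \<open>r' = 0\<close> or \<open>r = 0\<close> gives the
  comparison with the identity.\<close>

lemma fdist_concave:
  assumes "0 \<le> r" "0 \<le> r'" "0 < T"
  shows "fdist R T r' \<le> fdist R T r + exp (- min R r / T) * (r' - r)"
proof (cases "r \<le> r'")
  case True
  have "fdist R T r' - fdist R T r \<le> exp (- min R r / T) * (r' - r)"
  proof (rule has_integral_le[OF fdist_has_integral])
    show "((\<lambda>_. exp (- min R r / T)) has_integral exp (- min R r / T) * (r' - r)) {r..r'}"
      using has_integral_const_real[of "exp (- min R r / T)" r r'] True by (simp add: mult.commute)
  qed (use assms True in \<open>auto intro!: divide_right_mono\<close>)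
  then show ?thesis by simp
next
  case False
  have "exp (- min R r / T) * (r - r') \<le> fdist R T r - fdist R T r'"
  proof (rule has_integral_le[OF _ fdist_has_integral])
    show "((\<lambda>_. exp (- min R r / T)) has_integral exp (- min R r / T) * (r - r')) {r'..r}"
      using has_integral_const_real[of "exp (- min R r / T)" r' r] False by (simp add: mult.commute)
  qed (use assms False in \<open>auto intro!: divide_right_mono\<close>)
  then show ?thesis by (simp add: algebra_simps)
qed

lemma fdist_0 [simp]: "fdist R T 0 = 0"
  by (simp add: fdist_def)

lemma fdist_mono:
  assumes "0 \<le> r" "r \<le> r'" "0 < T"
  shows "fdist R T r \<le> fdist R T r'"
proof -
  have "fdist R T r \<le> fdist R T r' + exp (- min R r' / T) * (r - r')"
    using assms by (intro fdist_concave) auto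
  moreover have "exp (- min R r' / T) * (r - r') \<le> 0"
    using assms by (auto intro!: mult_nonneg_nonpos)
  ultimately show ?thesis by linarith
qed

lemma fdist_nonneg:
  assumes "0 \<le> r" "0 < T" shows "0 \<le> fdist R T r"
  using fdist_mono[of 0 r T R] assms by simp

lemma fdist_ge:
  assumes "0 \<le> r" "0 < T" shows "exp (- min R r / T) * r \<le> fdist R T r"
  using fdist_concave[OF assms(1) _ assms(2), of 0 R] by simp

lemma fdist_le:
  assumes "0 \<le> r" "0 < T" "0 \<le> R" shows "fdist R T r \<le> r"
  using fdist_concave[OF _ assms(1,2), of 0 R] assms by simp

text \<open>Slopes of \<open>fdist\<close> are at most 1, so an additive error in the distance, such
  as the mean-field one, passes through unchanged.\<close>

lemma fdist_le_add:
  assumes "0 \<le> r" "0 \<le> r'" "0 < T" "0 \<le> R" "r' \<le> x + d" "0 \<le> x" "0 \<le> d"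
  shows "fdist R T r' \<le> fdist R T x + d"
proof -
  have "fdist R T r' \<le> fdist R T (x + d)" using assms by (intro fdist_mono) auto
  also have "\<dots> \<le> fdist R T x + exp (- min R x / T) * ((x + d) - x)"
    using assms by (intro fdist_concave) auto
  also have "\<dots> \<le> fdist R T x + d"
    using assms mult_right_mono[of "exp (- min R x / T)" 1 d] by simp
  finally show ?thesis .
qed

lemma fdist_eq:
  assumes "0 \<le> r" "r \<le> R" "0 < T"
  shows "fdist R T r = T * (1 - exp (- r / T))"
proof -
  have "((\<lambda>s. exp (- min R s / T)) has_integral (- T * exp (- r / T)) - (- T * exp (- 0 / T))) {0..r}"
  proof (rule has_integral_eq)
    show "((\<lambda>s. exp (- s / T)) has_integral (- T * exp (- r / T)) - (- T * exp (- 0 / T))) {0..r}"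
      using assms by (intro fundamental_theorem_of_calculus)
        (auto intro!: derivative_eq_intros simp: has_real_derivative_iff_has_vector_derivative[symmetric])
  qed (use assms in auto)
  then show ?thesis unfolding fdist_def by (simp add: integral_unique algebra_simps)
qed

text \<open>Up to \<open>R\<close> the function is \<open>T * (1 - exp (- r / T))\<close>, so an
  increase within this range costs at most \<open>T * exp (- r / T)\<close> however far the point is
  thrown. Only the overshoot beyond \<open>R\<close> is charged further, at the minimal slope. This
  makes a rejected proposal affordable.\<close>

lemma fdist_increment_le:
  assumes "0 \<le> r" "r \<le> R" "0 \<le> r'" "0 < T" "r' - R \<le> d" "0 \<le> d"
  shows "fdist R T r' \<le> fdist R T r + T * exp (- r / T) + exp (- R / T) * d"
proof (cases "r' \<le> R")
  case True
  have "T * exp (- r' / T) \<ge> 0" "exp (- R / T) * d \<ge> 0" using assms by simp_all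
  moreover have "fdist R T r = T - T * exp (- r / T)" "fdist R T r' = T - T * exp (- r' / T)"
    using assms True by (simp_all add: fdist_eq right_diff_distrib)
  ultimately show ?thesis by linarith
next
  case False
  have "fdist R T r' \<le> fdist R T R + exp (- min R R / T) * (r' - R)"
    using assms False by (intro fdist_concave) auto
  also have "\<dots> \<le> fdist R T R + exp (- R / T) * d" using assms by simp
  also have "fdist R T R \<le> fdist R T r + T * exp (- r / T)"
  proof -
    have "T * exp (- R / T) \<ge> 0" using assms by simp
    moreover have "fdist R T r = T - T * exp (- r / T)" "fdist R T R = T - T * exp (- R / T)"
      using assms by (simp_all add: fdist_eq right_diff_distrib)
    ultimately show ?thesis by linarith
  qed
  finally show ?thesis by simp
qed

lemma borel_measurable_fdist [measurable]:
  assumes "0 < T" shows "fdist R T \<in> borel_measurable borel"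
proof (rule borel_measurable_mono)
  \<comment> \<open>For negative \<open>r\<close> the interval of integration is empty, which
    extends monotonicity to the whole line.\<close>
  have neg: "fdist R T r = 0" if "r < 0" for r using that by (simp add: fdist_def)
  show "mono (fdist R T)"
  proof
    fix r r' :: real assume "r \<le> r'"
    then show "fdist R T r \<le> fdist R T r'"
      using fdist_mono[of r r' T R] fdist_nonneg[of r' T R] neg[of r] neg[of r'] assms
      by (cases "r < 0"; cases "r' < 0") auto
  qed
qed

section \<open>Gaussian velocities\<close>

text \<open>\<open>nn_integral\<close> is a supremum over simple functions below the integrand, so
  Tonelli is applied to those alone and the inequality holds for arbitrary \<open>G\<close>. It
  points in the direction of an upper bound, which suits the distance between coupled
  endpoints.\<close>

lemma nn_integral_pair_le:
  assumes N: "sigma_finite_measure N"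
  shows "(\<integral>\<^sup>+ \<omega>. G \<omega> \<partial>(M \<Otimes>\<^sub>M N)) \<le> (\<integral>\<^sup>+ x. \<integral>\<^sup>+ y. G (x, y) \<partial>N \<partial>M)"
  unfolding nn_integral_def[of "M \<Otimes>\<^sub>M N"]
proof (rule SUP_least)
  interpret N: sigma_finite_measure N by fact
  fix g assume g: "g \<in> {g. simple_function (M \<Otimes>\<^sub>M N) g \<and> g \<le> G}"
  then have "integral\<^sup>S (M \<Otimes>\<^sub>M N) g = (\<integral>\<^sup>+ \<omega>. g \<omega> \<partial>(M \<Otimes>\<^sub>M N))"
    by (simp add: nn_integral_eq_simple_integral)
  also have "\<dots> = (\<integral>\<^sup>+ x. \<integral>\<^sup>+ y. g (x, y) \<partial>N \<partial>M)"
    using g by (intro N.nn_integral_fst[symmetric] borel_measurable_simple_function) auto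
  also have "\<dots> \<le> (\<integral>\<^sup>+ x. \<integral>\<^sup>+ y. G (x, y) \<partial>N \<partial>M)"
    using g by (intro nn_integral_mono) (auto simp: le_fun_def)
  finally show "integral\<^sup>S (M \<Otimes>\<^sub>M N) g \<le> (\<integral>\<^sup>+ x. \<integral>\<^sup>+ y. G (x, y) \<partial>N \<partial>M)" .
qed

lemma sets_std_normal_vec [measurable_cong, simp]: "sets std_normal_vec = sets borel"
  by (simp add: std_normal_vec_def)

lemma space_std_normal_vec [simp]: "space std_normal_vec = UNIV"
  by (simp add: std_normal_vec_def)

lemma std_normal_vec_density_prod:
  fixes x :: "'a::euclidean_space"
  shows "ennreal ((2 * pi) powr (- real DIM('a) / 2) * exp (- (norm x)\<^sup>2 / 2))
    = (\<Prod>b\<in>Basis. ennreal (std_normal_density (x \<bullet> b)))"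
proof -
  have "(\<Prod>b\<in>(Basis :: 'a set). std_normal_density (x \<bullet> b))
      = (1 / sqrt (2 * pi)) ^ DIM('a) * exp (\<Sum>b\<in>Basis. - (x \<bullet> b)\<^sup>2 / 2)"
    by (simp add: normal_density_def exp_sum prod.distrib[symmetric] prod_constant[symmetric]
        del: prod_constant)
  also have "(\<Sum>b\<in>Basis. - (x \<bullet> b)\<^sup>2 / 2) = - (norm x)\<^sup>2 / 2"
    by (simp add: sum_negf sum_divide_distrib[symmetric] power2_norm_eq_inner
        euclidean_inner[of x x] power2_eq_square[of "x \<bullet> _"])
  also have "(1 / sqrt (2 * pi)) ^ DIM('a) = (2 * pi) powr (- real DIM('a) / 2)"
    by (simp add: powr_half_sqrt[symmetric] powr_minus_divide[symmetric] powr_realpow[symmetric] powr_powr)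
  finally show ?thesis by (simp add: prod_ennreal)
qed

text \<open>The Gaussian density factorises over coordinates; total mass, marginals and independence
  of the coordinates are all read off from this identity.\<close>

lemma nn_integral_std_normal_vec_prod:
  fixes f :: "'a::euclidean_space \<Rightarrow> real \<Rightarrow> ennreal"
  assumes [measurable]: "\<And>b. b \<in> Basis \<Longrightarrow> f b \<in> borel_measurable borel"
  shows "(\<integral>\<^sup>+ x. (\<Prod>b\<in>Basis. f b (x \<bullet> b)) \<partial>std_normal_vec)
    = (\<Prod>b\<in>(Basis::'a set). \<integral>\<^sup>+ y. f b y \<partial>density lborel std_normal_density)"
proof -
  have [measurable]: "(\<lambda>x::'a. f b (x \<bullet> b)) \<in> borel_measurable borel" if "b \<in> Basis" for b
    using that by (intro measurable_compose[OF _ assms]) auto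
  have "(\<integral>\<^sup>+ x. (\<Prod>b\<in>Basis. f b (x \<bullet> b)) \<partial>std_normal_vec)
      = (\<integral>\<^sup>+ x. (\<Prod>b\<in>(Basis::'a set). ennreal (std_normal_density (x \<bullet> b)) * f b (x \<bullet> b)) \<partial>lborel)"
    unfolding std_normal_vec_def std_normal_vec_density_prod prod.distrib
    by (intro nn_integral_density) measurable
  also have "\<dots> = (\<Prod>b\<in>(Basis::'a set). \<integral>\<^sup>+ y. ennreal (std_normal_density y) * f b y \<partial>lborel)"
    by (intro nn_integral_lborel_prod) auto
  also have "\<dots> = (\<Prod>b\<in>(Basis::'a set). \<integral>\<^sup>+ y. f b y \<partial>density lborel std_normal_density)"
    by (intro prod.cong refl) (simp add: nn_integral_density)
  finally show ?thesis .
qed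

lemma prob_space_std_normal_density: "prob_space (density lborel (\<lambda>x. ennreal (std_normal_density x)))"
  by (rule prob_space_normal_density) simp

lemma prob_space_std_normal_vec: "prob_space (std_normal_vec :: 'a::euclidean_space measure)"
proof
  interpret N: prob_space "density lborel (\<lambda>x. ennreal (std_normal_density x))"
    by (rule prob_space_std_normal_density)
  have "(\<integral>\<^sup>+ x. 1 \<partial>(std_normal_vec :: 'a measure)) = 1"
    using nn_integral_std_normal_vec_prod[of "\<lambda>(_::'a) _. 1"] N.emeasure_space_1 by simp
  then show "emeasure (std_normal_vec :: 'a measure) (space std_normal_vec) = 1" by simp
qed

lemma std_normal_vec_box:
  fixes A :: "'a::euclidean_space \<Rightarrow> real set"
  assumes A: "\<And>b. b \<in> Basis \<Longrightarrow> A b \<in> sets borel"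
  shows "emeasure std_normal_vec {x. \<forall>b\<in>Basis. x \<bullet> b \<in> A b}
    = (\<Prod>b\<in>(Basis::'a set). emeasure (density lborel std_normal_density) (A b))"
proof -
  have [measurable]: "A b \<in> sets borel" if "b \<in> Basis" for b using A that .
  have "{x::'a. \<forall>b\<in>Basis. x \<bullet> b \<in> A b} \<in> sets borel"
  proof -
    have "{x::'a. \<forall>b\<in>Basis. x \<bullet> b \<in> A b} = (\<Inter>b\<in>Basis. (\<lambda>x. x \<bullet> b) -` A b \<inter> space borel)" by auto
    also have "\<dots> \<in> sets borel"
      by (intro sets.finite_INT) (auto intro!: measurable_sets_borel[OF _ A])
    finally show ?thesis .
  qed
  then have "emeasure std_normal_vec {x. \<forall>b\<in>(Basis::'a set). x \<bullet> b \<in> A b}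
      = (\<integral>\<^sup>+ x. indicator {x. \<forall>b\<in>Basis. x \<bullet> b \<in> A b} x \<partial>std_normal_vec)"
    by simp
  also have "\<dots> = (\<integral>\<^sup>+ x. (\<Prod>b\<in>(Basis::'a set). indicator (A b) (x \<bullet> b)) \<partial>std_normal_vec)"
    by (intro nn_integral_cong) (auto simp: indicator_def intro!: prod.neutral[symmetric])
  also have "\<dots> = (\<Prod>b\<in>(Basis::'a set). emeasure (density lborel std_normal_density) (A b))"
    by (subst nn_integral_std_normal_vec_prod) (auto intro!: prod.cong)
  finally show ?thesis .
qed

lemma distr_std_normal_vec_component:
  fixes b :: "'a::euclidean_space"
  assumes b: "b \<in> Basis"
  shows "distr std_normal_vec borel (\<lambda>x. x \<bullet> b) = density lborel std_normal_density"
proof (rule measure_eqI)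
  interpret N: prob_space "density lborel (\<lambda>x. ennreal (std_normal_density x))"
    by (rule prob_space_std_normal_density)
  fix A :: "real set" assume "A \<in> sets (distr std_normal_vec borel (\<lambda>x::'a. x \<bullet> b))"
  then have A: "A \<in> sets borel" by simp
  let ?A = "\<lambda>b'. if b' = b then A else UNIV"
  have "emeasure (distr std_normal_vec borel (\<lambda>x. x \<bullet> b)) A = emeasure std_normal_vec {x. \<forall>b'\<in>Basis. x \<bullet> b' \<in> ?A b'}"
    using A b by (subst emeasure_distr) (auto intro!: arg_cong[where f = "emeasure std_normal_vec"])
  also have "\<dots> = (\<Prod>b'\<in>(Basis::'a set). emeasure (density lborel std_normal_density) (?A b'))"
    using A by (intro std_normal_vec_box) auto
  also have "\<dots> = (\<Prod>b'\<in>(Basis::'a set). if b' = b then emeasure (density lborel std_normal_density) A else 1)"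
    using N.emeasure_space_1 by (intro prod.cong) auto
  also have "\<dots> = emeasure (density lborel std_normal_density) A" using b by simp
  finally show "emeasure (distr std_normal_vec borel (\<lambda>x. x \<bullet> b)) A = emeasure (density lborel std_normal_density) A" .
qed simp

lemma indep_vars_std_normal_vec:
  "prob_space.indep_vars (std_normal_vec :: 'a::euclidean_space measure) (\<lambda>_. borel) (\<lambda>b x. x \<bullet> b) Basis"
proof -
  interpret prob_space "std_normal_vec :: 'a measure" by (rule prob_space_std_normal_vec)
  interpret P: product_prob_space "\<lambda>_::'a. density lborel (\<lambda>x. ennreal (std_normal_density x))"
    by (intro product_prob_spaceI prob_space_std_normal_density)
  have "distr std_normal_vec (\<Pi>\<^sub>M b\<in>Basis. borel) (\<lambda>x. \<lambda>b\<in>(Basis::'a set). x \<bullet> b)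
      = (\<Pi>\<^sub>M b\<in>Basis. density lborel (\<lambda>x. ennreal (std_normal_density x)))"
  proof (rule P.PiM_eqI)
    show "sets (distr std_normal_vec (\<Pi>\<^sub>M b\<in>Basis. borel) (\<lambda>x. \<lambda>b\<in>(Basis::'a set). x \<bullet> b))
        = sets (\<Pi>\<^sub>M b\<in>Basis. density lborel (\<lambda>x. ennreal (std_normal_density x)))"
      by (simp cong: sets_PiM_cong)
    fix A :: "'a \<Rightarrow> real set"
    assume "\<And>i. i \<in> Basis \<Longrightarrow> A i \<in> sets (density lborel (\<lambda>x. ennreal (std_normal_density x)))"
    then have A: "\<And>i. i \<in> Basis \<Longrightarrow> A i \<in> sets borel" by simp
    have "emeasure (distr std_normal_vec (\<Pi>\<^sub>M b\<in>Basis. borel) (\<lambda>x. \<lambda>b\<in>(Basis::'a set). x \<bullet> b)) (Pi\<^sub>E Basis A)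
        = emeasure std_normal_vec {x. \<forall>b\<in>Basis. x \<bullet> b \<in> A b}"
      using A by (subst emeasure_distr)
        (auto intro!: sets_PiM_I_finite arg_cong[where f = "emeasure std_normal_vec"] simp: PiE_iff)
    also have "\<dots> = (\<Prod>b\<in>(Basis::'a set). emeasure (density lborel std_normal_density) (A b))"
      using A by (rule std_normal_vec_box)
    finally show "emeasure (distr std_normal_vec (\<Pi>\<^sub>M b\<in>Basis. borel) (\<lambda>x. \<lambda>b\<in>(Basis::'a set). x \<bullet> b)) (Pi\<^sub>E Basis A)
        = (\<Prod>b\<in>(Basis::'a set). emeasure (density lborel std_normal_density) (A b))" .
  qed simp
  then show ?thesis
    by (subst indep_vars_iff_distr_eq_PiM') (auto simp: distr_std_normal_vec_component cong: PiM_cong)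
qed

lemma distributed_std_normal_vec_inner:
  fixes e :: "'a::euclidean_space"
  assumes e: "norm e = 1"
  shows "distributed std_normal_vec lborel (\<lambda>x. e \<bullet> x) std_normal_density"
proof -
  interpret prob_space "std_normal_vec :: 'a measure" by (rule prob_space_std_normal_vec)
  \<comment> \<open>Coordinates with coefficient 0 are dropped, since a normal variable scaled by 0
    has no density. The others form a sum of independent centred normals whose variances add up to
    1.\<close>
  define I where "I = {b \<in> (Basis :: 'a set). e \<bullet> b \<noteq> 0}"
  have I: "finite I" "I \<subseteq> Basis" by (auto simp: I_def)
  have inner: "e \<bullet> x = (\<Sum>b\<in>I. 0 + (e \<bullet> b) * (x \<bullet> b))" for x
    unfolding euclidean_inner[of e x] by (rule sum.mono_neutral_cong_right) (auto simp: I_def)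
  have "I \<noteq> {}" using inner[of e] e by (auto simp: norm_eq_1)
  have sq: "(\<Sum>b\<in>I. (\<bar>e \<bullet> b\<bar> * 1)\<^sup>2) = 1"
    using inner[of e] e by (simp add: norm_eq_1 power2_eq_square)
  have "distributed std_normal_vec lborel (\<lambda>x. \<Sum>b\<in>I. 0 + (e \<bullet> b) * (x \<bullet> b))
      (normal_density (\<Sum>b\<in>I. 0 + (e \<bullet> b) * 0) (sqrt (\<Sum>b\<in>I. (\<bar>e \<bullet> b\<bar> * 1)\<^sup>2)))"
  proof (rule sum_indep_normal)
    have "indep_vars (\<lambda>_. borel) (\<lambda>b x. x \<bullet> b) I"
      using indep_vars_std_normal_vec I(2) by (rule indep_vars_subset)
    then show "indep_vars (\<lambda>_. borel) (\<lambda>b x. 0 + (e \<bullet> b) * (x \<bullet> b)) I"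
      using indep_vars_compose2[of "\<lambda>_. borel" "\<lambda>b x. x \<bullet> b" I "\<lambda>b y. 0 + (e \<bullet> b) * y" "\<lambda>_. borel"] by simp
    fix b assume b: "b \<in> I"
    have "distributed std_normal_vec lborel (\<lambda>x. x \<bullet> b) std_normal_density"
      unfolding distributed_def using distr_std_normal_vec_component[of b] b I
      by (auto cong: distr_cong)
    then show "distributed std_normal_vec lborel (\<lambda>x. 0 + (e \<bullet> b) * (x \<bullet> b)) (normal_density (0 + (e \<bullet> b) * 0) (\<bar>e \<bullet> b\<bar> * 1))"
      using b by (intro normal_density_affine) (auto simp: I_def)
  qed (use I \<open>I \<noteq> {}\<close> in \<open>auto simp: I_def\<close>)
  then show ?thesis unfolding sq inner[symmetric] by simp
qed

lemma std_normal_density_ratio: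
  "std_normal_density (g + a) / std_normal_density g = exp (- (a * g) - a\<^sup>2 / 2)"
  by (simp add: normal_density_def exp_diff[symmetric] power2_eq_square field_simps)

text \<open>\<open>(y + \<bar>y\<bar>) / 2\<close> is the positive part of y. Odd moments vanish, so
  its mean is s/2 and its mean against y^2 is s, where s is the mean of |y|, the square root of
  2/\<pi>. From \<pi> > 3 one gets s \<le> 21/25, the source of 21/50 and 21/25.\<close>

lemma std_normal_moments_le:
  fixes X y0 y1 a :: real
  assumes "0 \<le> a" "0 \<le> X" "0 \<le> y0" "0 \<le> y1"
  shows "(\<integral>\<^sup>+ y. ennreal (std_normal_density y)
      * ennreal (X + (y0 + y1 * y\<^sup>2) * (a * (y + \<bar>y\<bar>) / 2 + a\<^sup>2 / 2)) \<partial>lborel)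
    \<le> ennreal (X + y0 * (21 / 50 * a + a\<^sup>2 / 2) + y1 * (21 / 25 * a + a\<^sup>2 / 2))"
proof -
  define s where "s = sqrt (2 / pi)"
  have "s \<le> sqrt (2 / 3)" unfolding s_def using pi_gt3 by (intro real_sqrt_le_mono divide_left_mono) auto
  also have "\<dots> \<le> sqrt ((21 / 25)\<^sup>2)" by (intro real_sqrt_le_mono) (simp add: power2_eq_square)
  finally have s: "s \<le> 21 / 25" by simp
  have m0: "has_bochner_integral lborel (\<lambda>y. std_normal_density y) 1"
    using std_normal_moment_even[of 0] by simp
  have m2: "has_bochner_integral lborel (\<lambda>y. std_normal_density y * y\<^sup>2) 1"
    using std_normal_moment_even[of 1] by (simp add: fact_numeral)
  have m1: "has_bochner_integral lborel (\<lambda>y. std_normal_density y * y) 0"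
    using std_normal_moment_odd[of 0] by simp
  have m3: "has_bochner_integral lborel (\<lambda>y. std_normal_density y * y ^ 3) 0"
    using std_normal_moment_odd[of 1] by (simp add: numeral_3_eq_3)
  have a1: "has_bochner_integral lborel (\<lambda>y. std_normal_density y * \<bar>y\<bar>) s"
    using std_normal_moment_abs_odd[of 0] by (simp add: s_def)
  have a3: "has_bochner_integral lborel (\<lambda>y. std_normal_density y * \<bar>y\<bar> ^ 3) (2 * s)"
    using std_normal_moment_abs_odd[of 1] by (simp add: numeral_3_eq_3 s_def mult.commute)
  let ?g = "\<lambda>y. X + (y0 + y1 * y\<^sup>2) * (a * (y + \<bar>y\<bar>) / 2 + a\<^sup>2 / 2)"
  let ?h = "\<lambda>y. (X + y0 * a\<^sup>2 / 2) * std_normal_density y + (y0 * a / 2) * (std_normal_density y * y)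
      + (y0 * a / 2) * (std_normal_density y * \<bar>y\<bar>) + (y1 * a / 2) * (std_normal_density y * y ^ 3)
      + (y1 * a / 2) * (std_normal_density y * \<bar>y\<bar> ^ 3) + (y1 * a\<^sup>2 / 2) * (std_normal_density y * y\<^sup>2)"
  have h: "has_bochner_integral lborel ?h ((X + y0 * a\<^sup>2 / 2) * 1 + (y0 * a / 2) * 0
      + (y0 * a / 2) * s + (y1 * a / 2) * 0 + (y1 * a / 2) * (2 * s) + (y1 * a\<^sup>2 / 2) * 1)"
    by (intro has_bochner_integral_add has_bochner_integral_mult_right m0 m1 m2 m3 a1 a3)
  have cube: "\<bar>y\<bar> ^ 3 = y\<^sup>2 * \<bar>y\<bar>" for y :: real
    by (simp add: power3_eq_cube power2_eq_square abs_mult_self_eq)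
  have eq: "?h = (\<lambda>y. std_normal_density y * ?g y)"
    unfolding cube by (rule ext) (simp add: field_simps power2_eq_square power3_eq_cube)
  have nn: "0 \<le> ?g y" for y
  proof -
    have "0 \<le> y + \<bar>y\<bar>" by linarith
    then show ?thesis using assms by auto
  qed
  have "(\<integral>\<^sup>+ y. ennreal (std_normal_density y) * ennreal (?g y) \<partial>lborel)
      = (\<integral>\<^sup>+ y. ennreal (std_normal_density y * ?g y) \<partial>lborel)"
    by (intro nn_integral_cong) (simp add: ennreal_mult nn)
  also have "\<dots> = ennreal (integral\<^sup>L lborel (\<lambda>y. std_normal_density y * ?g y))"
    using h[unfolded eq] nn
    by (intro nn_integral_eq_integral AE_I2 mult_nonneg_nonneg) (auto simp: has_bochner_integral_iff)
  also have "\<dots> = ennreal (integral\<^sup>L lborel ?h)" by (simp only: eq)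
  also have "\<dots> \<le> ennreal (X + y0 * (21 / 50 * a + a\<^sup>2 / 2) + y1 * (21 / 25 * a + a\<^sup>2 / 2))"
  proof (rule ennreal_leI)
    have "y0 * a / 2 * s \<le> y0 * a / 2 * (21 / 25)" "y1 * a * s \<le> y1 * a * (21 / 25)"
      using mult_left_mono[OF s, of "y0 * a / 2"] mult_left_mono[OF s, of "y1 * a"] assms by simp_all
    then show "integral\<^sup>L lborel ?h \<le> X + y0 * (21 / 50 * a + a\<^sup>2 / 2) + y1 * (21 / 25 * a + a\<^sup>2 / 2)"
      unfolding has_bochner_integral_integral_eq[OF h] by (simp add: algebra_simps)
  qed
  finally show ?thesis .
qed

section \<open>Acceptance and rejection of the shifted velocity\<close>

lemma prob_space_unif01: "prob_space unif01"
  unfolding unif01_def by (rule prob_space_uniform_measure) auto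

lemma sets_unif01 [measurable_cong, simp]: "sets unif01 = sets borel"
  by (simp add: unif01_def)

lemma space_unif01 [simp]: "space unif01 = UNIV"
  by (simp add: unif01_def)

lemma emeasure_unif01_greaterThan:
  assumes "0 \<le> q" shows "emeasure unif01 {q<..} \<le> ennreal (1 - q)"
proof -
  have "emeasure unif01 {q<..} = emeasure lborel ({0..1} \<inter> {q<..})"
    by (simp add: unif01_def divide_ennreal_def)
  also have "\<dots> \<le> emeasure lborel {q..1}" using assms by (intro emeasure_mono) auto
  also have "\<dots> \<le> ennreal (1 - q)" by (auto simp: emeasure_lborel_Icc_eq)
  finally show ?thesis .
qed

text \<open>\<open>X\<close> is charged always, the excess
  \<open>y0 + y1 * (e \<bullet> xi)\<^sup>2\<close> only on rejection. Given \<open>xi\<close> with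
  g = \<open>e \<bullet> xi\<close>, rejection has probability at most the positive part of 1 - exp
  (- a g - a^2/2), hence at most a g^+ + a^2/2. The estimate thus sees \<open>xi\<close> only
  through a standard normal variable. The quadratic excess allows for reflections of large
  components.\<close>

lemma nn_integral_reflection_coupling_le:
  fixes e :: "'a::euclidean_space" and G :: "'a \<Rightarrow> real \<Rightarrow> real"
  assumes e: "norm e = 1" and nn: "0 \<le> a" "0 \<le> X" "0 \<le> y0" "0 \<le> y1"
    and acc: "\<And>xi u. u \<le> std_normal_density (e \<bullet> xi + a) / std_normal_density (e \<bullet> xi) \<Longrightarrow> G xi u \<le> X"
    and rej: "\<And>xi u. G xi u \<le> X + y0 + y1 * (e \<bullet> xi)\<^sup>2"
  shows "(\<integral>\<^sup>+ xi. \<integral>\<^sup>+ u. ennreal (G xi u) \<partial>unif01 \<partial>std_normal_vec)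
    \<le> ennreal (X + y0 * (21 / 50 * a + a\<^sup>2 / 2) + y1 * (21 / 25 * a + a\<^sup>2 / 2))"
proof -
  let ?g = "\<lambda>y. X + (y0 + y1 * y\<^sup>2) * (a * (y + \<bar>y\<bar>) / 2 + a\<^sup>2 / 2)"
  have "(\<integral>\<^sup>+ u. ennreal (G xi u) \<partial>unif01) \<le> ennreal (?g (e \<bullet> xi))" for xi
  proof -
    define g where "g = e \<bullet> xi"
    define q where "q = std_normal_density (g + a) / std_normal_density g"
    have q: "q = exp (- (a * g) - a\<^sup>2 / 2)" unfolding q_def by (rule std_normal_density_ratio)
    interpret U: prob_space unif01 by (rule prob_space_unif01)
    have y: "0 \<le> y0 + y1 * g\<^sup>2" using nn by auto
    have "(\<integral>\<^sup>+ u. ennreal (G xi u) \<partial>unif01)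
        \<le> (\<integral>\<^sup>+ u. ennreal X + ennreal (y0 + y1 * g\<^sup>2) * indicator {q<..} u \<partial>unif01)"
    proof (rule nn_integral_mono)
      fix u :: real
      show "ennreal (G xi u) \<le> ennreal X + ennreal (y0 + y1 * g\<^sup>2) * indicator {q<..} u"
      proof (cases "u \<le> q")
        case True
        then show ?thesis using acc[of u xi] by (auto simp: q_def g_def intro!: ennreal_leI)
      next
        case False
        then show ?thesis using rej[of xi u] nn y
          by (auto simp: g_def ennreal_plus[symmetric] add.assoc simp del: ennreal_plus intro!: ennreal_leI)
      qed
    qed
    also have "\<dots> = ennreal X + ennreal (y0 + y1 * g\<^sup>2) * emeasure unif01 {q<..}"
      using U.emeasure_space_1 by (subst nn_integral_add) (auto simp: nn_integral_cmult)
    also have "\<dots> \<le> ennreal X + ennreal (y0 + y1 * g\<^sup>2) * ennreal (a * (g + \<bar>g\<bar>) / 2 + a\<^sup>2 / 2)"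
    proof (intro add_left_mono mult_left_mono)
      have "1 - q \<le> a * g + a\<^sup>2 / 2" using exp_ge_add_one_self[of "- (a * g) - a\<^sup>2 / 2"] unfolding q by linarith
      also have "a * g \<le> a * (g + \<bar>g\<bar>) / 2"
        using mult_left_mono[of g "(g + \<bar>g\<bar>) / 2" a] nn by simp
      finally have "1 - q \<le> a * (g + \<bar>g\<bar>) / 2 + a\<^sup>2 / 2" by simp
      then show "emeasure unif01 {q<..} \<le> ennreal (a * (g + \<bar>g\<bar>) / 2 + a\<^sup>2 / 2)"
        by (rule order_trans[OF emeasure_unif01_greaterThan ennreal_leI, rotated]) (simp add: q)
    qed auto
    also have "\<dots> = ennreal (?g g)"
    proof -
      have "0 \<le> g + \<bar>g\<bar>" by linarith
      then have "0 \<le> a * (g + \<bar>g\<bar>) / 2 + a\<^sup>2 / 2" using nn by auto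
      then show ?thesis using y nn by (simp add: ennreal_mult[symmetric] ennreal_plus[symmetric] del: ennreal_plus)
    qed
    finally show ?thesis by (simp add: g_def)
  qed
  then have "(\<integral>\<^sup>+ xi. \<integral>\<^sup>+ u. ennreal (G xi u) \<partial>unif01 \<partial>std_normal_vec)
      \<le> (\<integral>\<^sup>+ xi. ennreal (?g (e \<bullet> xi)) \<partial>std_normal_vec)"
    by (intro nn_integral_mono)
  also have "\<dots> = (\<integral>\<^sup>+ y. ennreal (std_normal_density y) * ennreal (?g y) \<partial>lborel)"
    by (rule distributed_nn_integral[OF distributed_std_normal_vec_inner[OF e], symmetric]) measurable
  also have "\<dots> \<le> ennreal (X + y0 * (21 / 50 * a + a\<^sup>2 / 2) + y1 * (21 / 25 * a + a\<^sup>2 / 2))"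
    by (rule std_normal_moments_le[OF nn])
  finally show ?thesis .
qed

lemma integrable_norm_std_normal_vec:
  "integrable (std_normal_vec :: 'a::euclidean_space measure) norm"
proof (rule Bochner_Integration.integrable_bound)
  show "integrable (std_normal_vec :: 'a measure) (\<lambda>x. \<Sum>b\<in>Basis. \<bar>b \<bullet> x\<bar>)"
  proof (rule Bochner_Integration.integrable_sum)
    fix b :: 'a assume b: "b \<in> Basis"
    then have "integrable lborel (\<lambda>y. std_normal_density y *\<^sub>R \<bar>y\<bar>)"
      using integrable_std_normal_moment_abs[of 1] by simp
    then show "integrable std_normal_vec (\<lambda>x. \<bar>b \<bullet> x\<bar>)"
      using distributed_integrable[OF distributed_std_normal_vec_inner[of b], of "\<lambda>y. \<bar>y\<bar>"] b by simp
  qed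
  show "AE x in (std_normal_vec :: 'a measure). norm (norm x) \<le> norm (\<Sum>b\<in>Basis. \<bar>b \<bullet> x\<bar>)"
    using norm_le_l1 by (auto simp: inner_commute sum_nonneg)
qed simp

section \<open>Mean-field flows\<close>

lemma integrable_norm_of_second_moment:
  fixes M :: "'a::euclidean_space measure"
  assumes "prob_space M" and [measurable_cong, simp]: "sets M = sets borel"
    and "(\<integral>\<^sup>+ x. ennreal ((norm x)\<^sup>2) \<partial>M) < \<infinity>"
  shows "integrable M norm"
proof -
  interpret prob_space M by fact
  have i: "integrable M (\<lambda>x. (norm x)\<^sup>2)" using assms(3) by (intro integrableI_bounded) auto
  show ?thesis
  proof (rule Bochner_Integration.integrable_bound)
    show "integrable M (\<lambda>x. 1 + (norm x)\<^sup>2)" using i by simp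
    have "norm x \<le> 1 + (norm x)\<^sup>2" for x :: 'a
    proof -
      have "2 * norm x \<le> 1 + (norm x)\<^sup>2" using zero_le_power2[of "norm x - 1"] by (simp add: power2_diff)
      then show ?thesis using norm_ge_zero[of x] by linarith
    qed
    then show "AE x in M. norm (norm x) \<le> norm (1 + (norm x)\<^sup>2)" by auto
  qed simp
qed

section \<open>A single mean-field flow\<close>

locale mean_field_flow =
  fixes gradV :: "'a::euclidean_space \<Rightarrow> 'a" and grad1W :: "'a \<Rightarrow> 'a \<Rightarrow> 'a"
    and L Lt T eps :: real and mu :: "'a measure" and Q P :: "real \<Rightarrow> 'a \<Rightarrow> 'a \<Rightarrow> 'a"
  assumes V_lip: "\<And>x y. norm (gradV x - gradV y) \<le> L * norm (x - y)"
    and W_lip: "\<And>x y x' y'. norm (grad1W x y - grad1W x' y') \<le> Lt * (norm (x - x') + norm (y - y'))"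
    and L_pos: "0 < L" and Lt_nn: "0 \<le> Lt" and T_pos: "0 < T" and eps_nn: "0 \<le> eps"
    and small: "(L + eps * Lt) * T\<^sup>2 \<le> 4 / 25"
    and mu_prob: "prob_space mu" and sets_mu [measurable_cong, simp]: "sets mu = sets borel"
    and flow: "mf_flow gradV grad1W eps T mu Q P"
begin

abbreviation force :: "real \<Rightarrow> 'a \<Rightarrow> 'a" where
  "force t q \<equiv> \<integral>u. grad1W q u \<partial>(mf_law mu Q t)"

lemma Q_measurable: "t \<in> {0..T} \<Longrightarrow> (\<lambda>(x, v). Q t x v) \<in> borel_measurable (mu \<Otimes>\<^sub>M std_normal_vec)"
  and Q_0 [simp]: "Q 0 x v = x" and P_0 [simp]: "P 0 x v = v"
  and integrable_grad1W: "t \<in> {0..T} \<Longrightarrow> integrable (mf_law mu Q t) (grad1W (Q t x v))"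
  and Q_deriv: "t \<in> {0..T} \<Longrightarrow> ((\<lambda>s. Q s x v) has_vector_derivative P t x v) (at t within {0..T})"
  and P_deriv: "t \<in> {0..T} \<Longrightarrow> ((\<lambda>s. P s x v) has_vector_derivative
      - gradV (Q t x v) - eps *\<^sub>R force t (Q t x v)) (at t within {0..T})"
  using flow unfolding mf_flow_def by blast+

lemma prob_space_mf_law: "t \<in> {0..T} \<Longrightarrow> prob_space (mf_law mu Q t)"
  unfolding mf_law_def
  by (intro prob_space.prob_space_distr prob_space_pair mu_prob prob_space_std_normal_vec Q_measurable)

text \<open>Stated along trajectories because \<open>mf_flow\<close> supplies integrability of the
  interaction at the positions \<open>Q t x v\<close>.\<close>

lemma force_lipschitz:
  assumes t: "t \<in> {0..T}"
  shows "norm (force t (Q t x v) - force t (Q t y w)) \<le> Lt * norm (Q t x v - Q t y w)"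
proof -
  interpret prob_space "mf_law mu Q t" using t by (rule prob_space_mf_law)
  let ?f = "\<lambda>u. grad1W (Q t x v) u - grad1W (Q t y w) u"
  have i: "integrable (mf_law mu Q t) ?f" using t by (intro Bochner_Integration.integrable_diff integrable_grad1W)
  have "norm (force t (Q t x v) - force t (Q t y w)) = norm (\<integral>u. ?f u \<partial>mf_law mu Q t)"
    using t by (simp add: Bochner_Integration.integral_diff integrable_grad1W)
  also have "\<dots> \<le> (\<integral>u. norm (?f u) \<partial>mf_law mu Q t)" by (rule integral_norm_bound)
  also have "\<dots> \<le> (\<integral>u. Lt * norm (Q t x v - Q t y w) \<partial>mf_law mu Q t)"
  proof (intro integral_mono integrable_norm i)
    show "norm (?f u) \<le> Lt * norm (Q t x v - Q t y w)" for u using W_lip[of "Q t x v" u "Q t y w" u] by simp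
  qed simp
  finally show ?thesis using prob_space by simp
qed

text \<open>Both trajectories feel the same law, so the difference of their forces has no
  inhomogeneous part and the growth estimate applies with zero perturbation.\<close>

lemma Q_lipschitz:
  assumes t: "t \<in> {0..T}"
  shows "norm (Q t x v - Q t y w) \<le> 11 / 10 * (norm (x - y) + T * norm (v - w))"
proof -
  have "norm (Q t x v - Q t y w) \<le> 11 / 10 * ((norm (x - y) + T * norm (v - w)) + 0 * T\<^sup>2 / 2)"
  proof (rule second_order_growth)
    fix s assume s: "s \<in> {0..T}"
    show "((\<lambda>s. Q s x v - Q s y w) has_vector_derivative P s x v - P s y w) (at s within {0..T})"
      "((\<lambda>s. P s x v - P s y w) has_vector_derivative
        (- gradV (Q s x v) - eps *\<^sub>R force s (Q s x v)) - (- gradV (Q s y w) - eps *\<^sub>R force s (Q s y w)))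
        (at s within {0..T})"
      by (intro has_vector_derivative_diff Q_deriv P_deriv s)+
    have "norm ((- gradV (Q s x v) - eps *\<^sub>R force s (Q s x v)) - (- gradV (Q s y w) - eps *\<^sub>R force s (Q s y w)))
        = norm (- (gradV (Q s x v) - gradV (Q s y w)) - eps *\<^sub>R (force s (Q s x v) - force s (Q s y w)))"
      by (simp add: algebra_simps)
    also have "\<dots> \<le> norm (gradV (Q s x v) - gradV (Q s y w))
        + eps * norm (force s (Q s x v) - force s (Q s y w))"
      by (rule order_trans[OF norm_triangle_ineq4])
        (simp only: norm_minus_cancel norm_scaleR abs_of_nonneg[OF eps_nn] order_refl)
    also have "\<dots> \<le> L * norm (Q s x v - Q s y w) + eps * (Lt * norm (Q s x v - Q s y w))"
      using V_lip[of "Q s x v" "Q s y w"] mult_left_mono[OF force_lipschitz[OF s, of x v y w] eps_nn]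
      by (rule add_mono)
    finally show "norm ((- gradV (Q s x v) - eps *\<^sub>R force s (Q s x v))
        - (- gradV (Q s y w) - eps *\<^sub>R force s (Q s y w)))
      \<le> (L + eps * Lt) * norm (Q s x v - Q s y w) + 0" by (simp add: algebra_simps)
    have "norm (x - y + s *\<^sub>R (v - w)) \<le> norm (x - y) + s * norm (v - w)"
      using norm_triangle_ineq[of "x - y" "s *\<^sub>R (v - w)"] s by simp
    also have "s * norm (v - w) \<le> T * norm (v - w)" using s by (intro mult_right_mono) auto
    finally show "norm (Q 0 x v - Q 0 y w + s *\<^sub>R (P 0 x v - P 0 y w)) \<le> norm (x - y) + T * norm (v - w)"
      by simp
  qed (use small t L_pos eps_nn Lt_nn in auto)
  then show ?thesis by simp
qed

text \<open>One trajectory is bounded on the compact time interval and the Lipschitz estimate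
  compares all others with it. Uniformity in time serves to bound \<open>disp\<close> on the whole
  interval.\<close>

lemma Q_linear_growth:
  "\<exists>B. \<forall>t\<in>{0..T}. \<forall>x v. norm (Q t x v) \<le> B + 11 / 10 * (norm x + T * norm v)"
proof -
  have "continuous_on {0..T} (\<lambda>t. norm (Q t 0 0))"
    by (rule continuous_on_norm[OF continuous_on_vector_derivative[OF Q_deriv]])
  then have "\<exists>t0\<in>{0..T}. \<forall>t\<in>{0..T}. norm (Q t 0 0) \<le> norm (Q t0 0 0)"
    using T_pos by (intro continuous_attains_sup) auto
  then obtain t0 where t0: "\<And>t. t \<in> {0..T} \<Longrightarrow> norm (Q t 0 0) \<le> norm (Q t0 0 0)" by blast
  show ?thesis
  proof (intro exI ballI allI)
    fix t x v assume t: "t \<in> {0..T}"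
    have "norm (Q t x v) \<le> norm (Q t 0 0) + norm (Q t x v - Q t 0 0)"
      using norm_triangle_ineq[of "Q t 0 0" "Q t x v - Q t 0 0"] by simp
    then show "norm (Q t x v) \<le> norm (Q t0 0 0) + 11 / 10 * (norm x + T * norm v)"
      using t0[OF t] Q_lipschitz[OF t, of x v 0 0] unfolding diff_zero by linarith
  qed
qed

end

section \<open>Two flows with coupled initial positions\<close>

locale coupled_mean_field_flows =
  F: mean_field_flow gradV grad1W L Lt T eps mu Q P + F': mean_field_flow gradV grad1W L Lt T eps mu' Q' P'
  for gradV :: "'a::euclidean_space \<Rightarrow> 'a" and grad1W :: "'a \<Rightarrow> 'a \<Rightarrow> 'a"
    and L Lt T eps :: real and mu mu' :: "'a measure" and Q P Q' P' :: "real \<Rightarrow> 'a \<Rightarrow> 'a \<Rightarrow> 'a" +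
  fixes pi :: "('a \<times> 'a) measure"
  assumes pi_prob: "prob_space pi" and sets_pi [measurable_cong, simp]: "sets pi = sets borel"
    and pi_fst: "distr pi borel fst = mu" and pi_snd: "distr pi borel snd = mu'"
    and mu_int: "integrable mu norm" and mu'_int: "integrable mu' norm"
begin

abbreviation Om :: "(('a \<times> 'a) \<times> 'a) measure" where "Om \<equiv> pi \<Otimes>\<^sub>M std_normal_vec"

sublocale pi: prob_space pi by (rule pi_prob)
sublocale N: prob_space "std_normal_vec :: 'a measure" by (rule prob_space_std_normal_vec)
sublocale Om: prob_space Om by (intro prob_space_pair pi_prob prob_space_std_normal_vec)

lemma fst_measurable: "fst \<in> measurable pi mu"
  and snd_measurable: "snd \<in> measurable pi mu'"
proof -
  have "(fst :: 'a \<times> 'a \<Rightarrow> 'a) \<in> borel_measurable borel" "(snd :: 'a \<times> 'a \<Rightarrow> 'a) \<in> borel_measurable borel"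
    by (intro borel_measurable_continuous_onI continuous_intros)+
  then show "fst \<in> measurable pi mu" "snd \<in> measurable pi mu'"
    by (simp_all cong: measurable_cong_sets)
qed

lemma distr_Om_fst: "distr Om (mu \<Otimes>\<^sub>M std_normal_vec) (\<lambda>\<omega>. (fst (fst \<omega>), snd \<omega>)) = mu \<Otimes>\<^sub>M std_normal_vec"
  and distr_Om_snd: "distr Om (mu' \<Otimes>\<^sub>M std_normal_vec) (\<lambda>\<omega>. (snd (fst \<omega>), snd \<omega>)) = mu' \<Otimes>\<^sub>M std_normal_vec"
proof -
  have sf: "sigma_finite_measure (distr std_normal_vec (std_normal_vec :: 'a measure) (\<lambda>v. v))"
    by (simp add: N.sigma_finite_measure)
  have "distr pi mu fst = mu" "distr pi mu' snd = mu'"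
    using pi_fst pi_snd distr_cong[OF refl F.sets_mu refl, of pi fst] distr_cong[OF refl F'.sets_mu refl, of pi snd]
    by simp_all
  then show "distr Om (mu \<Otimes>\<^sub>M std_normal_vec) (\<lambda>\<omega>. (fst (fst \<omega>), snd \<omega>)) = mu \<Otimes>\<^sub>M std_normal_vec"
    "distr Om (mu' \<Otimes>\<^sub>M std_normal_vec) (\<lambda>\<omega>. (snd (fst \<omega>), snd \<omega>)) = mu' \<Otimes>\<^sub>M std_normal_vec"
    using pair_measure_distr[OF fst_measurable _ sf] pair_measure_distr[OF snd_measurable _ sf]
    by (simp_all add: split_beta')
qed

lemma Om_fst_measurable: "(\<lambda>\<omega>. (fst (fst \<omega>), snd \<omega>)) \<in> measurable Om (mu \<Otimes>\<^sub>M std_normal_vec)"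
  and Om_snd_measurable: "(\<lambda>\<omega>. (snd (fst \<omega>), snd \<omega>)) \<in> measurable Om (mu' \<Otimes>\<^sub>M std_normal_vec)"
  by (intro measurable_Pair measurable_compose[OF measurable_fst] measurable_snd fst_measurable snd_measurable)+

lemma Q_Om_measurable:
  assumes t: "t \<in> {0..T}"
  shows "(\<lambda>\<omega>. Q t (fst (fst \<omega>)) (snd \<omega>)) \<in> borel_measurable Om"
    and "(\<lambda>\<omega>. Q' t (snd (fst \<omega>)) (snd \<omega>)) \<in> borel_measurable Om"
  using measurable_compose[OF Om_fst_measurable F.Q_measurable[OF t]]
    measurable_compose[OF Om_snd_measurable F'.Q_measurable[OF t]] by simp_all

text \<open>Realises both laws on one space, where a single velocity accompanies the coupled
  pair.\<close>

lemma mf_law_eq_distr_Om: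
  assumes t: "t \<in> {0..T}"
  shows "mf_law mu Q t = distr Om borel (\<lambda>\<omega>. Q t (fst (fst \<omega>)) (snd \<omega>))"
    and "mf_law mu' Q' t = distr Om borel (\<lambda>\<omega>. Q' t (snd (fst \<omega>)) (snd \<omega>))"
proof -
  show "mf_law mu Q t = distr Om borel (\<lambda>\<omega>. Q t (fst (fst \<omega>)) (snd \<omega>))"
    unfolding mf_law_def by (subst distr_Om_fst[symmetric], subst distr_distr)
      (auto simp: o_def F.Q_measurable[OF t] Om_fst_measurable)
  show "mf_law mu' Q' t = distr Om borel (\<lambda>\<omega>. Q' t (snd (fst \<omega>)) (snd \<omega>))"
    unfolding mf_law_def by (subst distr_Om_snd[symmetric], subst distr_distr)
      (auto simp: o_def F'.Q_measurable[OF t] Om_snd_measurable)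
qed

lemma integrable_pi_norms:
  shows "integrable pi (\<lambda>z. norm (fst z))" and "integrable pi (\<lambda>z. norm (snd z))"
  using mu_int mu'_int integrable_distr[of fst pi borel norm] integrable_distr[of snd pi borel norm]
    fst_measurable snd_measurable
  by (simp_all add: pi_fst pi_snd cong: measurable_cong_sets)

lemma integrable_pi_dist: "integrable pi (\<lambda>z. norm (fst z - snd z))"
proof (rule Bochner_Integration.integrable_bound)
  show "integrable pi (\<lambda>z. norm (fst z) + norm (snd z))"
    by (intro Bochner_Integration.integrable_add integrable_pi_norms)
  have [measurable]: "fst \<in> borel_measurable pi" "snd \<in> borel_measurable pi"
    using fst_measurable snd_measurable by (simp_all cong: measurable_cong_sets)
  show "(\<lambda>z. norm (fst z - snd z)) \<in> borel_measurable pi" by measurable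
qed (auto intro!: norm_triangle_ineq4)

lemma integrable_Om_fst:
  assumes "integrable pi (f :: _ \<Rightarrow> real)" shows "integrable Om (\<lambda>\<omega>. f (fst \<omega>))"
    and "(\<integral>\<omega>. f (fst \<omega>) \<partial>Om) = (\<integral>z. f z \<partial>pi)"
proof -
  have [measurable]: "f \<in> borel_measurable pi" using assms by auto
  show "integrable Om (\<lambda>\<omega>. f (fst \<omega>))" "(\<integral>\<omega>. f (fst \<omega>) \<partial>Om) = (\<integral>z. f z \<partial>pi)"
    using assms integrable_distr_eq[of fst Om pi f] integral_distr[of fst Om pi f]
    unfolding N.distr_pair_fst by simp_all
qed

lemma integrable_Om_snd: "integrable Om (\<lambda>\<omega>. norm (snd \<omega>))"
proof (rule integrableI_bounded)
  have "(\<integral>\<^sup>+ \<omega>. ennreal (norm (norm (snd \<omega>))) \<partial>Om)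
      = (\<integral>\<^sup>+ z. \<integral>\<^sup>+ v. ennreal (norm v) \<partial>(std_normal_vec :: 'a measure) \<partial>pi)"
    by (subst N.nn_integral_fst[symmetric]) auto
  also have "\<dots> = (\<integral>\<^sup>+ v. ennreal (norm v) \<partial>(std_normal_vec :: 'a measure))"
    by (simp add: pi.emeasure_space_1)
  also have "\<dots> < \<infinity>"
    using integrable_norm_std_normal_vec[where ?'a = 'a] by (auto simp: integrable_iff_bounded)
  finally show "(\<integral>\<^sup>+ \<omega>. ennreal (norm (norm (snd \<omega>))) \<partial>Om) < \<infinity>" .
qed measurable

text \<open>The velocities are coupled synchronously here: the mean-field force does not see the coupling
  used for the transition step, only the laws.\<close>

definition disp :: "real \<Rightarrow> real" where
  "disp t = (\<integral>\<omega>. norm (Q t (fst (fst \<omega>)) (snd \<omega>) - Q' t (snd (fst \<omega>)) (snd \<omega>)) \<partial>Om)"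

text \<open>Finiteness has to come before the quantitative estimate: that one bounds the supremum of
  \<open>disp\<close> by a fraction of itself plus the initial distance, which says nothing unless
  the supremum is finite.\<close>

lemma integrable_disp: "t \<in> {0..T} \<Longrightarrow>
      integrable Om (\<lambda>\<omega>. norm (Q t (fst (fst \<omega>)) (snd \<omega>) - Q' t (snd (fst \<omega>)) (snd \<omega>)))"
  and disp_bounded: "\<exists>C. \<forall>t\<in>{0..T}. disp t \<le> C"
proof -
  obtain B where B: "\<And>t x v. t \<in> {0..T} \<Longrightarrow> norm (Q t x v) \<le> B + 11 / 10 * (norm x + T * norm v)"
    using F.Q_linear_growth by blast
  obtain B' where B': "\<And>t x v. t \<in> {0..T} \<Longrightarrow> norm (Q' t x v) \<le> B' + 11 / 10 * (norm x + T * norm v)"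
    using F'.Q_linear_growth by blast
  let ?b = "\<lambda>\<omega>. (B + 11 / 10 * (norm (fst (fst \<omega>)) + T * norm (snd \<omega>)))
    + (B' + 11 / 10 * (norm (snd (fst \<omega>)) + T * norm (snd \<omega>)))"
  have b: "integrable Om ?b"
    by (intro Bochner_Integration.integrable_add integrable_mult_right integrable_Om_fst(1)
        integrable_Om_snd integrable_pi_norms) auto
  have le: "norm (Q t (fst (fst \<omega>)) (snd \<omega>) - Q' t (snd (fst \<omega>)) (snd \<omega>)) \<le> ?b \<omega>" if "t \<in> {0..T}" for t \<omega>
    using B[OF that, of "fst (fst \<omega>)" "snd \<omega>"] B'[OF that, of "snd (fst \<omega>)" "snd \<omega>"]
      norm_triangle_ineq4[of "Q t (fst (fst \<omega>)) (snd \<omega>)" "Q' t (snd (fst \<omega>)) (snd \<omega>)"] by linarith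
  have int: "integrable Om (\<lambda>\<omega>. norm (Q t (fst (fst \<omega>)) (snd \<omega>) - Q' t (snd (fst \<omega>)) (snd \<omega>)))"
    if t: "t \<in> {0..T}" for t
  proof (rule Bochner_Integration.integrable_bound[OF b])
    show "(\<lambda>\<omega>. norm (Q t (fst (fst \<omega>)) (snd \<omega>) - Q' t (snd (fst \<omega>)) (snd \<omega>))) \<in> borel_measurable Om"
      using Q_Om_measurable[OF t] by simp
    have "norm (norm (Q t (fst (fst \<omega>)) (snd \<omega>) - Q' t (snd (fst \<omega>)) (snd \<omega>))) \<le> norm (?b \<omega>)" for \<omega>
      unfolding real_norm_def abs_norm_cancel by (rule order_trans[OF le[OF t] abs_ge_self])
    then show "AE \<omega> in Om. norm (norm (Q t (fst (fst \<omega>)) (snd \<omega>) - Q' t (snd (fst \<omega>)) (snd \<omega>))) \<le> norm (?b \<omega>)"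
      by simp
  qed
  have "disp t \<le> integral\<^sup>L Om ?b" if t: "t \<in> {0..T}" for t
    unfolding disp_def by (rule integral_mono[OF int[OF t] b le[OF t]])
  then show "\<exists>C. \<forall>t\<in>{0..T}. disp t \<le> C" by blast
  show "t \<in> {0..T} \<Longrightarrow>
      integrable Om (\<lambda>\<omega>. norm (Q t (fst (fst \<omega>)) (snd \<omega>) - Q' t (snd (fst \<omega>)) (snd \<omega>)))" by (rule int)
qed

lemma disp_nonneg: "0 \<le> disp t"
  unfolding disp_def by simp

text \<open>On \<open>Om\<close> the two mean-field integrals merge into one, so the Lipschitz bound
  on \<open>grad1W\<close> applies under the integral sign; its second argument contributes exactly
  \<open>disp t\<close>.\<close>

lemma force_difference:
  assumes t: "t \<in> {0..T}"
  shows "norm (F.force t (Q t x v) - F'.force t (Q' t x' v'))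
    \<le> Lt * (norm (Q t x v - Q' t x' v') + disp t)"
proof -
  let ?q = "Q t x v" and ?q' = "Q' t x' v'"
  let ?X = "\<lambda>\<omega>. Q t (fst (fst \<omega>)) (snd \<omega>)" and ?X' = "\<lambda>\<omega>. Q' t (snd (fst \<omega>)) (snd \<omega>)"
  note [measurable] = Q_Om_measurable[OF t]
  have m: "grad1W ?q \<in> borel_measurable borel" "grad1W ?q' \<in> borel_measurable borel"
    using F.integrable_grad1W[OF t, of x v] F'.integrable_grad1W[OF t, of x' v']
    by (auto simp: mf_law_def dest!: borel_measurable_integrable)
  have i: "integrable Om (\<lambda>\<omega>. grad1W ?q (?X \<omega>))" "integrable Om (\<lambda>\<omega>. grad1W ?q' (?X' \<omega>))"
    using F.integrable_grad1W[OF t, of x v] F'.integrable_grad1W[OF t, of x' v'] m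
    by (auto simp: mf_law_eq_distr_Om[OF t] integrable_distr_eq)
  have "norm (F.force t ?q - F'.force t ?q') = norm (\<integral>\<omega>. grad1W ?q (?X \<omega>) - grad1W ?q' (?X' \<omega>) \<partial>Om)"
    using i m by (simp add: mf_law_eq_distr_Om[OF t] integral_distr Bochner_Integration.integral_diff)
  also have "\<dots> \<le> (\<integral>\<omega>. norm (grad1W ?q (?X \<omega>) - grad1W ?q' (?X' \<omega>)) \<partial>Om)"
    by (rule integral_norm_bound)
  also have "\<dots> \<le> (\<integral>\<omega>. Lt * (norm (?q - ?q') + norm (?X \<omega> - ?X' \<omega>)) \<partial>Om)"
  proof (rule integral_mono)
    show "integrable Om (\<lambda>\<omega>. norm (grad1W ?q (?X \<omega>) - grad1W ?q' (?X' \<omega>)))"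
      by (intro integrable_norm Bochner_Integration.integrable_diff i)
    show "integrable Om (\<lambda>\<omega>. Lt * (norm (?q - ?q') + norm (?X \<omega> - ?X' \<omega>)))"
      by (intro integrable_mult_right Bochner_Integration.integrable_add integrable_disp t) simp
  qed (rule F.W_lip)
  also have "\<dots> = Lt * (norm (?q - ?q') + disp t)"
    using integrable_disp[OF t] by (simp add: disp_def Om.prob_space)
  finally show ?thesis .
qed

definition hdiff :: "'a \<Rightarrow> 'a \<Rightarrow> 'a \<Rightarrow> 'a \<Rightarrow> real \<Rightarrow> 'a" where
  "hdiff x v x' v' t = eps *\<^sub>R (F.force t (Q t x v) - F'.force t (Q' t x' v'))"

lemma diff_derivs:
  assumes "t \<in> {0..T}"
  shows "((\<lambda>s. Q s x v - Q' s x' v') has_vector_derivative P t x v - P' t x' v') (at t within {0..T})"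
    and "((\<lambda>s. P s x v - P' s x' v') has_vector_derivative
      - (gradV (Q t x v) - gradV (Q' t x' v')) - hdiff x v x' v' t) (at t within {0..T})"
proof -
  show "((\<lambda>s. Q s x v - Q' s x' v') has_vector_derivative P t x v - P' t x' v') (at t within {0..T})"
    by (intro has_vector_derivative_diff F.Q_deriv F'.Q_deriv assms)
  have "((\<lambda>s. P s x v - P' s x' v') has_vector_derivative
      (- gradV (Q t x v) - eps *\<^sub>R F.force t (Q t x v)) - (- gradV (Q' t x' v') - eps *\<^sub>R F'.force t (Q' t x' v')))
      (at t within {0..T})"
    by (intro has_vector_derivative_diff F.P_deriv F'.P_deriv assms)
  then show "((\<lambda>s. P s x v - P' s x' v') has_vector_derivative
      - (gradV (Q t x v) - gradV (Q' t x' v')) - hdiff x v x' v' t) (at t within {0..T})"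
    by (simp add: hdiff_def algebra_simps)
qed

lemma hdiff_le:
  assumes "t \<in> {0..T}" "disp t \<le> D"
  shows "norm (hdiff x v x' v' t) \<le> eps * Lt * norm (Q t x v - Q' t x' v') + eps * Lt * D"
proof -
  have "norm (hdiff x v x' v' t) \<le> eps * (Lt * (norm (Q t x v - Q' t x' v') + disp t))"
    using force_difference[OF assms(1), of x v x' v'] F.eps_nn by (simp add: hdiff_def mult_left_mono)
  also have "\<dots> \<le> eps * (Lt * (norm (Q t x v - Q' t x' v') + D))"
    using assms F.eps_nn F.Lt_nn by (intro mult_left_mono add_left_mono) auto
  finally show ?thesis by (simp add: algebra_simps)
qed

lemma acc_le:
  assumes "t \<in> {0..T}" "disp t \<le> D"
  shows "norm (- (gradV (Q t x v) - gradV (Q' t x' v')) - hdiff x v x' v' t)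
    \<le> (L + eps * Lt) * norm (Q t x v - Q' t x' v') + eps * Lt * D"
  using norm_triangle_ineq4[of "- (gradV (Q t x v) - gradV (Q' t x' v'))" "hdiff x v x' v' t"]
    hdiff_le[OF assms, of x v x' v'] F.V_lip[of "Q t x v" "Q' t x' v'"]
  unfolding norm_minus_cancel distrib_right by linarith

text \<open>\<open>m\<close> bounds the free motion of the difference, its path under zero
  acceleration. The choice of the two velocities enters only through \<open>m\<close>.\<close>

lemma diff_growth:
  assumes D: "\<And>s. s \<in> {0..T} \<Longrightarrow> disp s \<le> D"
    and m: "\<And>s. s \<in> {0..T} \<Longrightarrow> norm ((x - x') + s *\<^sub>R (v - v')) \<le> m"
    and t: "t \<in> {0..T}"
  shows "norm (Q t x v - Q' t x' v') \<le> 11 / 10 * (m + eps * Lt * D * T\<^sup>2 / 2)"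
proof (rule second_order_growth[OF diff_derivs acc_le[OF _ D]])
  have "0 \<le> D" using disp_nonneg[of t] D[OF t] by linarith
  then show "0 \<le> eps * Lt * D" using F.eps_nn F.Lt_nn by simp
qed (use m t F.small F.L_pos F.eps_nn F.Lt_nn in auto)

lemma diff_remainder:
  assumes D: "\<And>s. s \<in> {0..T} \<Longrightarrow> disp s \<le> D"
    and m: "\<And>s. s \<in> {0..T} \<Longrightarrow> norm ((x - x') + s *\<^sub>R (v - v')) \<le> m"
  shows "norm (Q T x v - Q' T x' v' - (x - x') - T *\<^sub>R (v - v'))
    \<le> ((L + eps * Lt) * (11 / 10 * (m + eps * Lt * D * T\<^sup>2 / 2)) + eps * Lt * D) * T\<^sup>2 / 2"
proof -
  have "norm (- (gradV (Q s x v) - gradV (Q' s x' v')) - hdiff x v x' v' s)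
      \<le> (L + eps * Lt) * (11 / 10 * (m + eps * Lt * D * T\<^sup>2 / 2)) + eps * Lt * D" if s: "s \<in> {0..T}" for s
  proof -
    have "(L + eps * Lt) * norm (Q s x v - Q' s x' v') \<le> (L + eps * Lt) * (11 / 10 * (m + eps * Lt * D * T\<^sup>2 / 2))"
      using F.L_pos F.eps_nn F.Lt_nn by (intro mult_left_mono diff_growth[OF D m s]) auto
    then show ?thesis using acc_le[OF s D[OF s], of x v x' v'] by linarith
  qed
  from second_order_remainder_bound[OF diff_derivs this, of T] F.T_pos show ?thesis by simp
qed

text \<open>With a common velocity the free motion is constant. Averaging the growth bound over
  \<open>Om\<close> gives D \<le> 11/10 (I + D/100) for the supremum D and the mean initial distance
  I, and absorbing D yields the factor 6/5.\<close>

lemma disp_le_initial: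
  assumes small': "eps * Lt * T\<^sup>2 \<le> 1 / 50"
  shows "\<exists>D\<ge>0. (\<forall>t\<in>{0..T}. disp t \<le> D) \<and> D \<le> 6 / 5 * (\<integral>z. norm (fst z - snd z) \<partial>pi)"
proof -
  obtain C where C: "\<And>t. t \<in> {0..T} \<Longrightarrow> disp t \<le> C" using disp_bounded by blast
  define D where "D = (SUP t\<in>{0..T}. disp t)"
  define I where "I = (\<integral>z. norm (fst z - snd z) \<partial>pi)"
  have bdd: "bdd_above (disp ` {0..T})" by (rule bdd_aboveI2[OF C])
  have D: "disp t \<le> D" if "t \<in> {0..T}" for t unfolding D_def by (rule cSUP_upper[OF that bdd])
  have D0: "0 \<le> D" using D[of 0] disp_nonneg[of 0] F.T_pos by simp
  note iz = integrable_pi_dist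
  have "disp t \<le> 11 / 10 * (I + D / 50 / 2)" if t: "t \<in> {0..T}" for t
  proof -
    have "disp t \<le> (\<integral>\<omega>. 11 / 10 * (norm (fst (fst \<omega>) - snd (fst \<omega>)) + eps * Lt * D * T\<^sup>2 / 2) \<partial>Om)"
      unfolding disp_def
    proof (rule integral_mono[OF integrable_disp[OF t]])
      show "integrable Om (\<lambda>\<omega>. 11 / 10 * (norm (fst (fst \<omega>) - snd (fst \<omega>)) + eps * Lt * D * T\<^sup>2 / 2))"
        by (intro integrable_mult_right Bochner_Integration.integrable_add integrable_Om_fst(1)[OF iz]) simp
    qed (rule diff_growth[OF D _ t], auto)
    also have "\<dots> = 11 / 10 * (I + eps * Lt * D * T\<^sup>2 / 2)"
      using integrable_Om_fst[OF iz] by (simp add: I_def Om.prob_space)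
    also have "eps * Lt * D * T\<^sup>2 \<le> D / 50"
      using mult_right_mono[OF small' D0] by (simp add: mult_ac)
    finally show ?thesis by simp
  qed
  then have "D \<le> 11 / 10 * (I + D / 50 / 2)"
    unfolding D_def using F.T_pos by (intro cSUP_least) auto
  with D0 have "D \<le> 6 / 5 * I" by simp
  with D D0 show ?thesis unfolding I_def by blast
qed

end

section \<open>One coupled transition step\<close>

text \<open>This is the factor by which the summand \<open>5 / 4 * (2 * T)\<close> of
  \<open>R1\<close> lowers the slope of f. Below, 1 + 1/2 + 1/8 = 13/8 is raised to the fifth power;
  above, 3^5 = 243 < 16^2. The 11 makes an overshoot beyond \<open>R1\<close> cheap, the 16 enters
  the final rate.\<close>

lemma exp_five_halves: "11 \<le> exp (5 / 2 :: real)" "exp (5 / 2 :: real) \<le> 16"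
proof -
  have "(13 / 8 :: real) ^ 5 \<le> exp (1 / 2) ^ 5"
    using exp_lower_Taylor_quadratic[of "1 / 2 :: real"] by (intro power_mono) (auto simp: power2_eq_square)
  also have "exp (1 / 2 :: real) ^ 5 = exp (5 / 2)" by (simp add: exp_of_nat_mult[symmetric])
  finally show "11 \<le> exp (5 / 2 :: real)" by (simp add: power_numeral_reduce)
  show "exp (5 / 2 :: real) \<le> 16"
  proof (rule power2_le_imp_le)
    have "(exp (5 / 2 :: real))\<^sup>2 = exp 1 ^ 5" by (simp add: exp_of_nat_mult[symmetric])
    also have "\<dots> \<le> 3 ^ 5" using exp_le by (intro power_mono) auto
    finally show "(exp (5 / 2 :: real))\<^sup>2 \<le> 16\<^sup>2" by simp
  qed simp
qed

context coupled_mean_field_flows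
begin

text \<open>If the total perturbation \<open>H * T\<^sup>2\<close> exceeds a tenth of the initial
  distance r, the growth bound 11/10 r suffices: its excess r/10 is dominated by the mean-field
  error, for which the coefficient 2 leaves room. Otherwise the estimate in the convex region
  applies, and lowering 37/100 to 9/25 pays for the part of \<open>H\<close> proportional to
  r.\<close>

lemma diff_far:
  assumes D: "\<And>s. s \<in> {0..T} \<Longrightarrow> disp s \<le> D"
    and K: "0 < K" "4 * K \<le> L" and LT: "L * T\<^sup>2 \<le> 3 / 20" and e1: "eps * Lt * T\<^sup>2 \<le> K * T\<^sup>2 / 1000"
    and conv: "\<And>x y. norm (x - y) \<ge> Rc \<Longrightarrow>
        (x - y) \<bullet> (gradV x - gradV y) \<ge> K * (norm (x - y))\<^sup>2 + (norm (gradV x - gradV y))\<^sup>2 / L"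
    and far: "(norm (x - x'))\<^sup>2 \<ge> 3 / 2 * Rc\<^sup>2"
  shows "norm (Q T x v - Q' T x' v) \<le> (1 - 9 / 25 * (K * T\<^sup>2)) * norm (x - x') + 2 * (eps * Lt * D * T\<^sup>2)"
proof -
  define r where "r = norm (x - x')"
  define h where "h = eps * Lt * D"
  define M where "M = 11 / 10 * (r + h * T\<^sup>2 / 2)"
  define H where "H = eps * Lt * M + h"
  have T: "0 < T" by (rule F.T_pos)
  have D0: "0 \<le> D" using D[of T] disp_nonneg[of T] T by simp
  have eL: "0 \<le> eps * Lt" using F.eps_nn F.Lt_nn by simp
  have h0: "0 \<le> h" using eL D0 by (simp add: h_def)
  have r0: "0 \<le> r" by (simp add: r_def)
  have hT: "0 \<le> h * T\<^sup>2" using h0 by simp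
  have M0: "0 \<le> M" using r0 hT by (simp add: M_def)
  have KT: "K * T\<^sup>2 \<le> 3 / 80" "0 \<le> K * T\<^sup>2"
    using mult_right_mono[OF K(2), of "T\<^sup>2"] LT K by simp_all
  have zM: "norm (Q s x v - Q' s x' v) \<le> M" if "s \<in> {0..T}" for s
    using diff_growth[OF D _ that, of x x' v v r] by (simp add: M_def h_def r_def)
  have HT: "H * T\<^sup>2 = (eps * Lt * T\<^sup>2) * M + h * T\<^sup>2" by (simp add: H_def algebra_simps)
  have e1M: "(eps * Lt * T\<^sup>2) * M \<le> K * T\<^sup>2 / 1000 * M" using e1 M0 by (rule mult_right_mono)
  have eM0: "0 \<le> (eps * Lt * T\<^sup>2) * M" using eL M0 by simp
  have KTr: "0 \<le> K * T\<^sup>2 * r" "K * T\<^sup>2 * r \<le> 3 / 80 * r" using KT(2) r0 mult_right_mono[OF KT(1) r0] by simp_all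
  have KTh: "K * T\<^sup>2 * (h * T\<^sup>2) \<le> 3 / 80 * (h * T\<^sup>2)" using KT hT by (intro mult_right_mono)
  have HT': "H * T\<^sup>2 \<le> K * T\<^sup>2 * r * (11 / 10000) + K * T\<^sup>2 * (h * T\<^sup>2) * (11 / 20000) + h * T\<^sup>2"
    using e1M unfolding HT by (simp add: M_def algebra_simps)
  show ?thesis
  proof (cases "H * T\<^sup>2 \<le> r / 10")
    case True
    have hr: "h * T\<^sup>2 \<le> r / 10" using True eM0 unfolding HT by linarith
    have "norm (Q T x v - Q' T x' v) \<le> (1 - 37 / 100 * K * T\<^sup>2) * norm (Q 0 x v - Q' 0 x' v) + 51 / 100 * (H * T\<^sup>2)"
    proof (rule second_order_far_contraction[where Rc = Rc and L = L])
      show "\<And>s. s \<in> {0..T} \<Longrightarrow> ((\<lambda>s. Q s x v - Q' s x' v) has_vector_derivative P s x v - P' s x' v) (at s within {0..T})"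
        "\<And>s. s \<in> {0..T} \<Longrightarrow> ((\<lambda>s. P s x v - P' s x' v) has_vector_derivative
          - (gradV (Q s x v) - gradV (Q' s x' v)) - hdiff x v x' v s) (at s within {0..T})"
        by (rule diff_derivs, assumption)+
      have lip: "L-lipschitz_on UNIV gradV"
        using F.V_lip F.L_pos by (intro lipschitz_onI) (auto simp: dist_norm)
      show "continuous_on {0..T} (\<lambda>s. gradV (Q s x v) - gradV (Q' s x' v))"
        by (intro continuous_on_diff continuous_on_compose2[OF lipschitz_on_continuous_on[OF lip]]
            continuous_on_vector_derivative[OF F.Q_deriv] continuous_on_vector_derivative[OF F'.Q_deriv]) auto
      show "norm (gradV (Q s x v) - gradV (Q' s x' v)) \<le> L * norm (Q s x v - Q' s x' v)" for s
        by (rule F.V_lip)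
      fix s assume s: "s \<in> {0..T}"
      show "Rc \<le> norm (Q s x v - Q' s x' v) \<Longrightarrow> K * (norm (Q s x v - Q' s x' v))\<^sup>2
          + (norm (gradV (Q s x v) - gradV (Q' s x' v)))\<^sup>2 / L
          \<le> (Q s x v - Q' s x' v) \<bullet> (gradV (Q s x v) - gradV (Q' s x' v))" by (rule conv)
      show "norm (hdiff x v x' v s) \<le> H"
        using hdiff_le[OF s D[OF s], of x v x' v] mult_left_mono[OF zM[OF s] eL] by (simp add: H_def h_def)
      \<comment> \<open>Here 1155/1000 = 11/10 * (1 + 1/20), as \<open>h * T\<^sup>2 / 2\<close> is
        at most r/20.\<close>
      have "M \<le> 1155 / 1000 * r" using hr r0 by (simp add: M_def)
      then show "norm (Q s x v - Q' s x' v) \<le> 1155 / 1000 * norm (Q 0 x v - Q' 0 x' v)"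
        using zM[OF s] by (simp add: r_def)
    qed (use far T F.L_pos LT K True in \<open>auto simp: r_def\<close>)
    then have "norm (Q T x v - Q' T x' v) \<le> r - 37 / 100 * (K * T\<^sup>2 * r) + 51 / 100 * (H * T\<^sup>2)"
      by (simp add: r_def algebra_simps)
    with HT' KTh KTr hT have "norm (Q T x v - Q' T x' v) \<le> r - 9 / 25 * (K * T\<^sup>2 * r) + 2 * (h * T\<^sup>2)"
      by linarith
    then show ?thesis by (simp add: r_def h_def algebra_simps)
  next
    case False
    have "norm (Q T x v - Q' T x' v) \<le> 11 / 10 * r + 11 / 20 * (h * T\<^sup>2)"
      using zM[of T] T by (simp add: M_def)
    with HT' KTh KTr hT r0 False have "norm (Q T x v - Q' T x' v) \<le> r - 9 / 25 * (K * T\<^sup>2 * r) + 2 * (h * T\<^sup>2)"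
      by linarith
    then show ?thesis by (simp add: r_def h_def algebra_simps)
  qed
qed

text \<open>The relative velocity is \<open>- g *\<^sub>R (x - x')\<close>, so free motion shrinks
  the difference by the factor \<open>1 - g * T\<close>. Since \<open>L * T\<^sup>2\<close> is small
  relative to \<open>g * T\<close>, the force remainder takes only 151/1000 * 11/20 < 9/100 of this
  gain, up to the mean-field term; 91/100 is left.\<close>

lemma diff_near_accept:
  assumes D: "\<And>s. s \<in> {0..T} \<Longrightarrow> disp s \<le> D"
    and g: "0 \<le> g" "g * T \<le> 1" and LT: "L * T\<^sup>2 \<le> 3 / 20 * (g * T)"
    and e1: "eps * Lt * T\<^sup>2 \<le> g * T / 1000"
  shows "norm (Q T x v - Q' T x' (v + g *\<^sub>R (x - x')))
    \<le> (1 - 91 / 100 * (g * T)) * norm (x - x') + 11 / 20 * (eps * Lt * D * T\<^sup>2)"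
proof -
  define r where "r = norm (x - x')"
  define h where "h = eps * Lt * D"
  define p where "p = g * T"
  have T: "0 < T" by (rule F.T_pos)
  have D0: "0 \<le> D" using D[of T] disp_nonneg[of T] T by simp
  have eL: "0 \<le> eps * Lt" using F.eps_nn F.Lt_nn by simp
  have hT: "0 \<le> h * T\<^sup>2" using eL D0 by (simp add: h_def)
  have r0: "0 \<le> r" by (simp add: r_def)
  have p: "0 \<le> p" "p \<le> 1" using g T by (auto simp: p_def)
  let ?v' = "v + g *\<^sub>R (x - x')"
  have "norm ((x - x') + s *\<^sub>R (v - ?v')) \<le> r" if s: "s \<in> {0..T}" for s
  proof -
    have "s * g \<le> 1" "0 \<le> s * g" using s g mult_right_mono[of s T g] by (auto simp: mult.commute)
    moreover have "(x - x') + s *\<^sub>R (v - ?v') = (1 - s * g) *\<^sub>R (x - x')" by (simp add: algebra_simps)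
    ultimately show ?thesis using mult_right_mono[of "1 - s * g" 1 r] r0 by (simp add: r_def)
  qed
  from diff_remainder[OF D this]
  have "norm (Q T x v - Q' T x' ?v' - (x - x') - T *\<^sub>R (v - ?v'))
      \<le> ((L + eps * Lt) * (11 / 10 * (r + h * T\<^sup>2 / 2)) + h) * T\<^sup>2 / 2" by (simp add: h_def)
  also have "\<dots> = (L * T\<^sup>2 + eps * Lt * T\<^sup>2) * (11 / 20 * (r + h * T\<^sup>2 / 2)) + h * T\<^sup>2 / 2"
  proof -
    have "(a * (11 / 10 * b) + c) * t / 2 = (a * t) * (11 / 20 * b) + c * t / 2" for a b c t :: real
      by (simp add: field_simps)
    from this[of "L + eps * Lt"] show ?thesis by (simp only: distrib_right[of L "eps * Lt" "T\<^sup>2"])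
  qed
  also have "\<dots> \<le> (3 / 20 * p + p / 1000) * (11 / 20 * (r + h * T\<^sup>2 / 2)) + h * T\<^sup>2 / 2"
    using LT e1 r0 hT by (intro add_right_mono mult_right_mono add_mono) (auto simp: p_def)
  also have "\<dots> \<le> 9 / 100 * (p * r) + 11 / 20 * (h * T\<^sup>2)"
  proof -
    have "p * (h * T\<^sup>2) \<le> 1 * (h * T\<^sup>2)" using p hT by (intro mult_right_mono)
    moreover have "0 \<le> p * r" using p r0 by simp
    moreover have "(3 / 20 * p + p / 1000) * (11 / 20 * (r + h * T\<^sup>2 / 2))
        = 151 / 1000 * (11 / 20) * (p * r) + 151 / 1000 * (11 / 40) * (p * (h * T\<^sup>2))"
      by (simp add: algebra_simps)
    ultimately show ?thesis using hT by linarith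
  qed
  finally have rem: "norm (Q T x v - Q' T x' ?v' - (x - x') - T *\<^sub>R (v - ?v')) \<le> 9 / 100 * (p * r) + 11 / 20 * (h * T\<^sup>2)" .
  have "(x - x') + T *\<^sub>R (v - ?v') = (1 - p) *\<^sub>R (x - x')" by (simp add: algebra_simps p_def)
  then have "norm ((x - x') + T *\<^sub>R (v - ?v')) = (1 - p) * r" using p by (simp add: r_def)
  moreover have "norm (Q T x v - Q' T x' ?v') \<le> norm ((x - x') + T *\<^sub>R (v - ?v'))
      + norm (Q T x v - Q' T x' ?v' - (x - x') - T *\<^sub>R (v - ?v'))"
    using norm_triangle_ineq[of "(x - x') + T *\<^sub>R (v - ?v')" "Q T x v - Q' T x' ?v' - (x - x') - T *\<^sub>R (v - ?v')"]
    by simp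
  ultimately show ?thesis using rem by (simp add: r_def h_def p_def algebra_simps)
qed

lemma diff_near_reflect:
  assumes D: "\<And>s. s \<in> {0..T} \<Longrightarrow> disp s \<le> D" and e: "norm e = 1"
  shows "norm (Q T x v - Q' T x' (v - (2 * y) *\<^sub>R e))
    \<le> 11 / 10 * (norm (x - x') + 2 * T * \<bar>y\<bar>) + 11 / 20 * (eps * Lt * D * T\<^sup>2)"
proof -
  have "norm (Q T x v - Q' T x' (v - (2 * y) *\<^sub>R e))
      \<le> 11 / 10 * (norm (x - x') + 2 * T * \<bar>y\<bar> + eps * Lt * D * T\<^sup>2 / 2)"
  proof (rule diff_growth[OF D])
    fix s assume s: "s \<in> {0..T}"
    have "norm ((x - x') + s *\<^sub>R (v - (v - (2 * y) *\<^sub>R e))) \<le> norm (x - x') + s * (2 * \<bar>y\<bar>)"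
      using norm_triangle_ineq[of "x - x'" "s *\<^sub>R (v - (v - (2 * y) *\<^sub>R e))"] s e by (simp add: abs_mult)
    also have "s * (2 * \<bar>y\<bar>) \<le> T * (2 * \<bar>y\<bar>)" using s by (intro mult_right_mono) auto
    finally show "norm ((x - x') + s *\<^sub>R (v - (v - (2 * y) *\<^sub>R e))) \<le> norm (x - x') + 2 * T * \<bar>y\<bar>"
      by simp
  qed (use F.T_pos in auto)
  then show ?thesis by (simp add: field_simps)
qed

text \<open>With p = \<open>g * T\<close> and E the slope of f at r, every term is a multiple of p r
  E, because T E (g r) = p r E. Acceptance gains 91/100. Rejection costs 109/200 for the jump,
  193/4000 for its quadratic tail and 91/100 * 109/800 for returning the gain; the balance exceeds
  9/50.\<close>

lemma coupling_step_near:
  assumes D: "\<And>s. s \<in> {0..T} \<Longrightarrow> disp s \<le> D"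
    and g: "0 \<le> g" "g * T \<le> 1" "4 * g * Rt \<le> 1" and LT: "L * T\<^sup>2 \<le> 3 / 20 * (g * T)"
    and e1: "eps * Lt * T\<^sup>2 \<le> g * T / 1000" and R: "R = 5 / 4 * (Rt + 2 * T)"
    and near: "norm (x - x') < Rt"
  shows "(\<integral>\<^sup>+ xi. \<integral>\<^sup>+ u. ennreal (rho R T (Q T x xi) (Q' T x' (coup_eta Rt g x x' xi u))) \<partial>unif01 \<partial>std_normal_vec)
    \<le> ennreal (fdist R T (norm (x - x')) - 9 / 50 * (g * T) * norm (x - x') * exp (- R / T)
        + 11 / 20 * (eps * Lt * D * T\<^sup>2))"
proof -
  define r where "r = norm (x - x')"
  define d where "d = 11 / 20 * (eps * Lt * D * T\<^sup>2)"
  define p where "p = g * T"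
  define E where "E = exp (- r / T)"
  define e where "e = (if x - x' \<noteq> 0 then (1 / norm (x - x')) *\<^sub>R (x - x') else (SOME b. b \<in> (Basis :: 'a set)))"
  have T: "0 < T" by (rule F.T_pos)
  have e: "norm e = 1"
    unfolding e_def using norm_Basis[OF SOME_Basis] by auto
  have D0: "0 \<le> D" using D[of T] disp_nonneg[of T] T by simp
  have d0: "0 \<le> d" using F.eps_nn F.Lt_nn D0 by (simp add: d_def)
  have r: "0 \<le> r" "r < Rt" using near by (simp_all add: r_def)
  have rR: "r + 5 / 2 * T \<le> R" using r T by (simp add: R)
  then have rR': "r \<le> R" "0 \<le> R" using r T by linarith+
  have mr: "min R r = r" using rR' by simp
  have p: "0 \<le> p" "p \<le> 1" using g T by (auto simp: p_def)
  have a: "0 \<le> g * r" "g * r \<le> 1 / 4"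
    using g r mult_left_mono[of r Rt g] by auto
  have E: "0 < E" by (simp add: E_def)
  \<comment> \<open>The slope at \<open>R\<close> is at most 1/11 of the slope at \<open>r\<close>,
    which turns 11/20 into the 1/20 of \<open>refl\<close>.\<close>
  have ER: "exp (- R / T) \<le> E / 11"
  proof -
    have "exp (- R / T) * 11 \<le> exp (- R / T) * exp (5 / 2)"
      using exp_five_halves by (intro mult_left_mono) auto
    also have "\<dots> = exp ((5 / 2 * T - R) / T)" using T by (simp add: exp_add[symmetric] field_simps)
    also have "\<dots> \<le> E" unfolding E_def using rR T by (intro iffD2[OF exp_le_cancel_iff] divide_right_mono) auto
    finally show ?thesis by simp
  qed
  define X where "X = fdist R T r - 91 / 100 * p * r * E + d"
  have rE: "0 \<le> p * (r * E)" "p * (r * E) \<le> r * E"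
    using p r E mult_right_mono[of p 1 "r * E"] by auto
  have X0: "0 \<le> X"
    using fdist_ge[OF r(1) T, of R] d0 rE unfolding mr E_def[symmetric] X_def by (simp add: mult_ac)
  let ?G = "\<lambda>xi u. rho R T (Q T x xi) (Q' T x' (coup_eta Rt g x x' xi u))"
  have acc: "rho R T (Q T x xi) (Q' T x' (xi + g *\<^sub>R (x - x'))) \<le> X" for xi
  proof -
    have "norm (Q T x xi - Q' T x' (xi + g *\<^sub>R (x - x'))) \<le> (1 - 91 / 100 * p) * r + d"
      using diff_near_accept[OF D g(1,2) LT e1, of x xi x'] by (simp add: r_def p_def d_def)
    then have "rho R T (Q T x xi) (Q' T x' (xi + g *\<^sub>R (x - x'))) \<le> fdist R T ((1 - 91 / 100 * p) * r) + d"
      unfolding rho_def using p r d0 T rR' by (intro fdist_le_add[OF r(1)]) auto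
    moreover have "fdist R T ((1 - 91 / 100 * p) * r) \<le> fdist R T r + exp (- min R r / T) * ((1 - 91 / 100 * p) * r - r)"
      using p r T by (intro fdist_concave) auto
    ultimately show ?thesis unfolding mr E_def[symmetric] X_def by (simp add: algebra_simps)
  qed
  have refl: "rho R T (Q T x xi) (Q' T x' (xi - (2 * (e \<bullet> xi)) *\<^sub>R e)) \<le> fdist R T r + T * E + T * E / 20 * (e \<bullet> xi)\<^sup>2 + d" for xi
  proof -
    let ?y = "e \<bullet> xi"
    have "norm (Q T x xi - Q' T x' (xi - (2 * ?y) *\<^sub>R e)) \<le> 11 / 10 * (r + 2 * T * \<bar>?y\<bar>) + d"
      using diff_near_reflect[OF D e, of x xi x' ?y] by (simp add: r_def d_def)
    then have "rho R T (Q T x xi) (Q' T x' (xi - (2 * ?y) *\<^sub>R e)) \<le> fdist R T (11 / 10 * (r + 2 * T * \<bar>?y\<bar>)) + d"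
      unfolding rho_def using r d0 T rR' by (intro fdist_le_add[OF r(1)]) auto
    moreover have "fdist R T (11 / 10 * (r + 2 * T * \<bar>?y\<bar>)) \<le> fdist R T r + T * exp (- r / T) + exp (- R / T) * (11 / 20 * T * ?y\<^sup>2)"
    proof (rule fdist_increment_le)
      \<comment> \<open>Young's inequality T |y| \<le> T y^2 / 4 + T splits the overshoot. The two
        summands of \<open>R\<close> are made for what remains: \<open>5 / 4 * Rt\<close> covers
        11/10 r, and 5/2 T covers 11/5 T.\<close>
      have "0 \<le> T * (\<bar>?y\<bar> / 2 - 1)\<^sup>2" using T by simp
      also have "(\<bar>?y\<bar> / 2 - 1)\<^sup>2 = ?y\<^sup>2 / 4 - \<bar>?y\<bar> + 1" by (simp add: power2_diff power_divide)
      finally have "T * \<bar>?y\<bar> \<le> T * ?y\<^sup>2 / 4 + T" by (simp add: algebra_simps)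
      moreover have "11 / 10 * (r + 2 * T * \<bar>?y\<bar>) - R = 11 / 10 * r - 5 / 4 * Rt + 11 / 5 * (T * \<bar>?y\<bar>) - 5 / 2 * T"
        by (simp add: R field_simps)
      ultimately show "11 / 10 * (r + 2 * T * \<bar>?y\<bar>) - R \<le> 11 / 20 * T * ?y\<^sup>2"
        using r T unfolding mult.assoc[of "11 / 20"] by linarith
    qed (use r T rR' in auto)
    moreover have "exp (- R / T) * (11 / 20 * T * ?y\<^sup>2) \<le> E / 11 * (11 / 20 * T * ?y\<^sup>2)"
      using T by (intro mult_right_mono ER) auto
    ultimately show ?thesis by (simp add: E_def mult_ac)
  qed
  have eta: "coup_eta Rt g x x' xi u = (if u \<le> std_normal_density (e \<bullet> xi + g * r) / std_normal_density (e \<bullet> xi)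
      then xi + g *\<^sub>R (x - x') else xi - (2 * (e \<bullet> xi)) *\<^sub>R e)" for xi u
    using near unfolding coup_eta_def Let_def e_def[symmetric] by (simp add: r_def)
  have TE: "0 \<le> T * E" using T E by simp
  have "(\<integral>\<^sup>+ xi. \<integral>\<^sup>+ u. ennreal (?G xi u) \<partial>unif01 \<partial>std_normal_vec)
      \<le> ennreal (X + (T * E + 91 / 100 * p * r * E) * (21 / 50 * (g * r) + (g * r)\<^sup>2 / 2)
          + T * E / 20 * (21 / 25 * (g * r) + (g * r)\<^sup>2 / 2))"
  proof (rule nn_integral_reflection_coupling_le[OF e a(1) X0])
    \<comment> \<open>The constant excess contains 91/100 p r E because \<open>X\<close> already
      includes the gain of acceptance, which a rejection has to give back.\<close>
    show "0 \<le> T * E + 91 / 100 * p * r * E" using TE rE by (simp add: mult.assoc)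
    show "0 \<le> T * E / 20" using TE by simp
    fix xi u
    show "u \<le> std_normal_density (e \<bullet> xi + g * r) / std_normal_density (e \<bullet> xi) \<Longrightarrow> ?G xi u \<le> X"
      using acc[of xi] by (simp add: eta)
    have "0 \<le> T * E / 20 * (e \<bullet> xi)\<^sup>2" using TE by simp
    then show "?G xi u \<le> X + (T * E + 91 / 100 * p * r * E) + T * E / 20 * (e \<bullet> xi)\<^sup>2"
      using acc[of xi] refl[of xi] TE rE unfolding eta X_def by (auto simp: mult.assoc)
  qed
  also have "\<dots> \<le> ennreal (fdist R T r - 9 / 50 * p * r * exp (- R / T) + d)"
  proof (rule ennreal_leI)
    \<comment> \<open>From \<open>g * r \<le> 1 / 4\<close> the quadratic part of the rejection
      probability is at most an eighth of \<open>g * r\<close>: 109/200 = 21/50 + 1/8 and 193/200 =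
      21/25 + 1/8.\<close>
    have sq: "(g * r)\<^sup>2 / 2 \<le> g * r / 8" using mult_left_mono[OF a(2,1)] by (simp add: power2_eq_square mult_ac)
    have "(T * E + 91 / 100 * p * r * E) * (21 / 50 * (g * r) + (g * r)\<^sup>2 / 2)
        \<le> (T * E + 91 / 100 * p * r * E) * (109 / 200 * (g * r))"
      using sq TE rE by (intro mult_left_mono) (auto simp: mult.assoc)
    also have "\<dots> = 109 / 200 * (T * E * (g * r)) + 91 / 100 * (p * (r * E)) * (109 / 200 * (g * r))"
      by (simp add: algebra_simps)
    finally have "(T * E + 91 / 100 * p * r * E) * (21 / 50 * (g * r) + (g * r)\<^sup>2 / 2)
        \<le> 109 / 200 * (T * E * (g * r)) + 91 / 100 * (p * (r * E)) * (109 / 200 * (g * r))" .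
    moreover have "T * E / 20 * (21 / 25 * (g * r) + (g * r)\<^sup>2 / 2) \<le> T * E / 20 * (193 / 200 * (g * r))"
      using sq TE by (intro mult_left_mono) auto
    moreover have "T * E / 20 * (193 / 200 * (g * r)) = 193 / 4000 * (T * E * (g * r))" by simp
    moreover have "X = fdist R T r - 91 / 100 * (p * (r * E)) + d" by (simp add: X_def)
    moreover have "9 / 50 * p * r * exp (- R / T) = 9 / 50 * (p * r * exp (- R / T))" "p * r * E = p * (r * E)"
      by simp_all
    moreover have "91 / 100 * (p * (r * E)) * (109 / 200 * (g * r)) \<le> 91 / 100 * (p * (r * E)) * (109 / 200 * (1 / 4))"
      using a rE by (intro mult_left_mono) auto
    moreover have "T * E * (g * r) = p * (r * E)" by (simp add: p_def)
    moreover have "p * r * exp (- R / T) \<le> p * r * E"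
      using ER E p r by (intro mult_left_mono) auto
    ultimately show "X + (T * E + 91 / 100 * p * r * E) * (21 / 50 * (g * r) + (g * r)\<^sup>2 / 2)
          + T * E / 20 * (21 / 25 * (g * r) + (g * r)\<^sup>2 / 2)
        \<le> fdist R T r - 9 / 50 * p * r * exp (- R / T) + d"
      using rE by linarith
  qed
  finally show ?thesis by (simp only: r_def p_def d_def)
qed

text \<open>Beyond \<open>Rt\<close> the velocities coincide and the contraction holds for each of
  them, so the average is trivial. Measuring the gain by the minimal slope
  \<open>exp (- R / T)\<close> makes it uniform in the distance.\<close>

lemma coupling_step_far:
  assumes D: "\<And>s. s \<in> {0..T} \<Longrightarrow> disp s \<le> D"
    and K: "0 < K" "4 * K \<le> L" and LT: "L * T\<^sup>2 \<le> 3 / 20" and e1: "eps * Lt * T\<^sup>2 \<le> K * T\<^sup>2 / 1000"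
    and conv: "\<And>x y. norm (x - y) \<ge> Rc \<Longrightarrow>
        (x - y) \<bullet> (gradV x - gradV y) \<ge> K * (norm (x - y))\<^sup>2 + (norm (gradV x - gradV y))\<^sup>2 / L"
    and Rt: "0 \<le> Rt" "3 / 2 * Rc\<^sup>2 \<le> Rt\<^sup>2" and R: "0 \<le> R" and far: "Rt \<le> norm (x - x')"
  shows "(\<integral>\<^sup>+ xi. \<integral>\<^sup>+ u. ennreal (rho R T (Q T x xi) (Q' T x' (coup_eta Rt g x x' xi u))) \<partial>unif01 \<partial>std_normal_vec)
    \<le> ennreal (fdist R T (norm (x - x')) - 9 / 25 * (K * T\<^sup>2) * norm (x - x') * exp (- R / T)
        + 2 * (eps * Lt * D * T\<^sup>2))"
proof -
  define r where "r = norm (x - x')"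
  define d where "d = 2 * (eps * Lt * D * T\<^sup>2)"
  define k where "k = 9 / 25 * (K * T\<^sup>2)"
  have T: "0 < T" by (rule F.T_pos)
  have D0: "0 \<le> D" using D[of T] disp_nonneg[of T] T by simp
  have d0: "0 \<le> d" using F.eps_nn F.Lt_nn D0 by (simp add: d_def)
  have r: "0 \<le> r" by (simp add: r_def)
  have k: "0 \<le> k" "k \<le> 1" using mult_right_mono[OF K(2), of "T\<^sup>2"] LT K by (simp_all add: k_def)
  have "Rt\<^sup>2 \<le> (norm (x - x'))\<^sup>2" using far Rt(1) by (rule power_mono)
  with Rt(2) have far': "3 / 2 * Rc\<^sup>2 \<le> (norm (x - x'))\<^sup>2" by (rule order_trans)
  have "rho R T (Q T x xi) (Q' T x' (coup_eta Rt g x x' xi u)) \<le> fdist R T r - k * r * exp (- R / T) + d" for xi u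
  proof -
    have eta: "coup_eta Rt g x x' xi u = xi" using far by (simp add: coup_eta_def Let_def)
    have "norm (Q T x xi - Q' T x' xi) \<le> (1 - k) * r + d"
      using diff_far[OF D K LT e1 conv far'] by (simp add: r_def k_def d_def)
    then have "rho R T (Q T x xi) (Q' T x' xi) \<le> fdist R T ((1 - k) * r) + d"
      unfolding rho_def using k r d0 T R by (intro fdist_le_add[OF r]) auto
    moreover have "fdist R T ((1 - k) * r) \<le> fdist R T r + exp (- min R r / T) * ((1 - k) * r - r)"
      using k r T by (intro fdist_concave) auto
    moreover have "k * r * exp (- R / T) \<le> k * r * exp (- min R r / T)"
      using k r T by (intro mult_left_mono) (auto intro!: divide_right_mono)
    ultimately show ?thesis unfolding eta by (simp add: algebra_simps)
  qed
  then have "(\<integral>\<^sup>+ xi. \<integral>\<^sup>+ u. ennreal (rho R T (Q T x xi) (Q' T x' (coup_eta Rt g x x' xi u))) \<partial>unif01 \<partial>std_normal_vec)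
      \<le> (\<integral>\<^sup>+ xi. \<integral>\<^sup>+ u. ennreal (fdist R T r - k * r * exp (- R / T) + d) \<partial>unif01 \<partial>(std_normal_vec :: 'a measure))"
    by (intro nn_integral_mono ennreal_leI)
  also have "\<dots> = ennreal (fdist R T r - k * r * exp (- R / T) + d)"
    using prob_space.emeasure_space_1[OF prob_space_unif01] N.emeasure_space_1 by simp
  finally show ?thesis by (simp only: r_def k_def d_def)
qed

end

section \<open>Numerical consequences of the hypotheses on the parameters\<close>

lemma convexity_modulus_le:
  fixes gradV :: "'a::euclidean_space \<Rightarrow> 'a"
  assumes L: "0 < L" and K: "0 < K"
    and conv: "\<And>x y. norm (x - y) \<ge> Rc \<Longrightarrow>
        (x - y) \<bullet> (gradV x - gradV y) \<ge> K * (norm (x - y))\<^sup>2 + (norm (gradV x - gradV y))\<^sup>2 / L"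
  shows "4 * K \<le> L"
proof -
  obtain b :: 'a where b: "b \<in> Basis" using nonempty_Basis by blast
  define x where "x = (\<bar>Rc\<bar> + 1) *\<^sub>R b"
  define n where "n = norm (x - 0)"
  define d where "d = norm (gradV x - gradV 0)"
  have n: "n = \<bar>Rc\<bar> + 1" using b by (simp add: n_def x_def)
  then have "Rc \<le> norm (x - 0)" unfolding n_def by linarith
  \<comment> \<open>For one pair beyond \<open>Rc\<close>, co-coercivity and Cauchy--Schwarz give K
    n^2 + d^2/L \<le> n d, while Young's inequality gives n d \<le> d^2/L + L n^2/4; the terms in d
    cancel.\<close>
  from order_trans[OF conv[OF this] norm_cauchy_schwarz]
  have "K * n\<^sup>2 + d\<^sup>2 / L \<le> n * d" by (simp only: n_def d_def)
  moreover have "0 \<le> (d - L * n / 2)\<^sup>2 / L" using L by simp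
  then have "n * d \<le> d\<^sup>2 / L + L / 4 * n\<^sup>2"
    using L by (simp add: power2_eq_square field_simps)
  ultimately have "K * n\<^sup>2 \<le> L / 4 * n\<^sup>2" by linarith
  moreover have "0 < n\<^sup>2" using n by simp
  ultimately show ?thesis by simp
qed

lemma LT_bound_gam:
  assumes L: "0 < L" and T: "0 < T" and Rt: "0 \<le> Rt" and LT: "L * T\<^sup>2 \<le> 3 / 5 * LT_bound L Rt"
  shows "L * T\<^sup>2 \<le> 3 / 20" "0 \<le> gam Rt T" "gam Rt T * T \<le> 1" "4 * gam Rt T * Rt \<le> 1"
    "L * T\<^sup>2 \<le> 3 / 20 * (gam Rt T * T)"
proof -
  show A: "L * T\<^sup>2 \<le> 3 / 20" using LT by (auto simp: LT_bound_def split: if_splits)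
  show "0 \<le> gam Rt T" using T Rt by (auto simp: gam_def)
  show "gam Rt T * T \<le> 1" using T mult_right_mono[of "gam Rt T" "1 / T" T] by (auto simp: gam_def)
  show "4 * gam Rt T * Rt \<le> 1"
  proof (cases "Rt = 0")
    case False
    then have "gam Rt T * (4 * Rt) \<le> 1 / (4 * Rt) * (4 * Rt)"
      using Rt by (intro mult_right_mono) (auto simp: gam_def)
    then show ?thesis using False by (simp add: mult_ac)
  qed simp
  show "L * T\<^sup>2 \<le> 3 / 20 * (gam Rt T * T)"
  proof (cases "Rt = 0")
    case True then show ?thesis using A T by (simp add: gam_def)
  next
    case False
    then have Rt': "0 < Rt" using Rt by simp
    have "L * T\<^sup>2 \<le> 3 / 5 * (3 / (256 * 5 * L * Rt\<^sup>2))" using LT False by (auto simp: LT_bound_def)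
    then have "L * T\<^sup>2 * (L * Rt\<^sup>2) \<le> 3 / 5 * (3 / (256 * 5 * L * Rt\<^sup>2)) * (L * Rt\<^sup>2)"
      using L by (intro mult_right_mono) auto
    \<comment> \<open>The hypothesis is a perfect square, 3/5 * 3/(256 * 5) = (3/80)^2. Its root is
      the claim for the branch \<open>1 / (4 * Rt)\<close> of \<open>gam\<close>, as 3/80 = 3/20 *
      1/4.\<close>
    then have "(L * T * Rt)\<^sup>2 \<le> (3 / 80)\<^sup>2"
      using L Rt' by (simp add: power_mult_distrib power2_eq_square mult_ac)
    then have "L * T * Rt \<le> 3 / 80" by (rule power2_le_imp_le) simp
    then have "L * T * T \<le> 3 / 80 / Rt * T"
      using T Rt' by (intro mult_right_mono) (auto simp: field_simps)
    then have B: "L * T\<^sup>2 \<le> 3 / 20 * (1 / (4 * Rt) * T)" by (simp add: power2_eq_square mult_ac)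
    show ?thesis using A B T False by (auto simp: gam_def min_def)
  qed
qed

text \<open>\<open>4 * K \<le> L\<close> makes the number under the root at least 9/6, which is the
  slack that keeps distant trajectories in the convex region.\<close>

lemma Rtil_bounds:
  assumes "0 < K" "4 * K \<le> L" "0 \<le> Rc"
  shows "0 \<le> Rtil L K Rc" "3 / 2 * Rc\<^sup>2 \<le> (Rtil L K Rc)\<^sup>2"
proof -
  have q: "3 / 2 \<le> (2 * L + K) / (6 * K)" using assms by (simp add: field_simps)
  show "0 \<le> Rtil L K Rc" using assms by (simp add: Rtil_def)
  have "3 / 2 * Rc\<^sup>2 \<le> (2 * L + K) / (6 * K) * Rc\<^sup>2" using q by (intro mult_right_mono) auto
  also have "\<dots> = (Rtil L K Rc)\<^sup>2" unfolding Rtil_def power_mult_distrib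
    by (subst real_sqrt_pow2) (use q in linarith, rule refl)
  finally show "3 / 2 * Rc\<^sup>2 \<le> (Rtil L K Rc)\<^sup>2" .
qed

theorem mainTheorem2:
  fixes V :: "'a::euclidean_space \<Rightarrow> real" and gradV :: "'a \<Rightarrow> 'a"
    and W :: "'a \<Rightarrow> 'a \<Rightarrow> real" and grad1W :: "'a \<Rightarrow> 'a \<Rightarrow> 'a"
    and L K Rc Lt T eps :: real
    and mu mu' :: "'a measure" and pi :: "('a \<times> 'a) measure"
    and Q P Q' P' :: "real \<Rightarrow> 'a \<Rightarrow> 'a \<Rightarrow> 'a"
  assumes gradV: "\<forall>x. GDERIV V x :> gradV x"
    and grad1W: "\<forall>x y. GDERIV (\<lambda>z. W z y) x :> grad1W x y"
    and L_pos: "L > 0" and K_pos: "K > 0" and Rc_nn: "Rc \<ge> 0" and Lt_nn: "Lt \<ge> 0"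
    and V0: "V 0 = 0" and V_nn: "\<forall>x. V x \<ge> 0"
    and V_lip: "\<forall>x y. norm (gradV x - gradV y) \<le> L * norm (x - y)"
    and V_conv: "\<forall>x y. norm (x - y) \<ge> Rc \<longrightarrow>
        (x - y) \<bullet> (gradV x - gradV y) \<ge> K * (norm (x - y))\<^sup>2 + (norm (gradV x - gradV y))\<^sup>2 / L"
    and W_sym: "\<forall>x y. W x y = W y x"
    and W_lip: "\<forall>x y x' y'. norm (grad1W x y - grad1W x' y') \<le> Lt * (norm (x - x') + norm (y - y'))"
    and mu: "prob_space mu" "sets mu = sets borel" "(\<integral>\<^sup>+ x. ennreal ((norm x)\<^sup>2) \<partial>mu) < \<infinity>"
    and mu': "prob_space mu'" "sets mu' = sets borel" "(\<integral>\<^sup>+ x. ennreal ((norm x)\<^sup>2) \<partial>mu') < \<infinity>"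
    and T_pos: "T > 0" and eps_nn: "eps \<ge> 0"
    and LT: "L * T\<^sup>2 \<le> 3 / 5 * LT_bound L (Rtil L K Rc)"
    and epsLt: "eps * Lt \<le> 5 / 64 * K / sqrt (7 / 6 + 3 / (2 * K * T\<^sup>2))
                   * exp (- 5 * Rtil L K Rc / (2 * T) - 5)"
    and pi: "prob_space pi" "sets pi = sets borel" "distr pi borel fst = mu" "distr pi borel snd = mu'"
    and flow: "mf_flow gradV grad1W eps T mu Q P"
    and flow': "mf_flow gradV grad1W eps T mu' Q' P'"
  shows "(\<integral>\<^sup>+ \<omega>. ennreal (case \<omega> of ((x, x'), (xi, u)) \<Rightarrow>
              rho (R1 (Rtil L K Rc) T) T
                (Q T x xi)
                (Q' T x' (coup_eta (Rtil L K Rc) (gam (Rtil L K Rc) T) x x' xi u)))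
            \<partial>(pi \<Otimes>\<^sub>M (std_normal_vec \<Otimes>\<^sub>M unif01)))
         \<le> ennreal (1 - K * T\<^sup>2 / 156 * exp (- 5 * Rtil L K Rc / (4 * T)))
            * (\<integral>\<^sup>+ z. ennreal (rho (R1 (Rtil L K Rc) T) T (fst z) (snd z)) \<partial>pi)"
proof -
  define Rt where "Rt = Rtil L K Rc"
  define R where "R = R1 Rt T"
  define g where "g = gam Rt T"
  define E where "E = exp (- R / T)"
  have conv: "(x - y) \<bullet> (gradV x - gradV y) \<ge> K * (norm (x - y))\<^sup>2 + (norm (gradV x - gradV y))\<^sup>2 / L"
    if "norm (x - y) \<ge> Rc" for x y
    using V_conv that by blast
  have KL: "4 * K \<le> L" by (rule convexity_modulus_le[OF L_pos K_pos conv])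
  have Rt: "0 \<le> Rt" "3 / 2 * Rc\<^sup>2 \<le> Rt\<^sup>2"
    unfolding Rt_def by (rule Rtil_bounds[OF K_pos KL Rc_nn])+
  have LT': "L * T\<^sup>2 \<le> 3 / 5 * LT_bound L Rt" using LT by (simp only: Rt_def)
  note gam = LT_bound_gam[OF L_pos T_pos Rt(1) LT', folded g_def]
  have R_eq: "R = 5 / 4 * (Rt + 2 * T)" by (simp add: R_def R1_def)
  then have R0: "0 \<le> R" using Rt T_pos by simp
  have KT: "4 * (K * T\<^sup>2) \<le> L * T\<^sup>2" "0 \<le> K * T\<^sup>2"
    using mult_right_mono[OF KL, of "T\<^sup>2"] K_pos by simp_all
  have E: "0 < E" by (simp add: E_def)
  have RT: "R / T = 5 / 4 * (Rt / T) + 5 / 2" using T_pos by (simp add: R_eq field_simps)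
  \<comment> \<open>The minimal slope \<open>E\<close> is exp (- 5 / 2) times the exponential in the
    rate; its square is the exponential in the bound on \<open>eps * Lt\<close>.\<close>
  have E5: "E * exp (5 / 2) = exp (- 5 * Rt / (4 * T))"
    using RT by (simp add: E_def exp_add[symmetric])
  have EE: "E * E = exp (- 5 * Rt / (2 * T) - 5)"
    using RT by (simp add: E_def exp_add[symmetric])
  have E_le: "E \<le> 1 / 11"
  proof -
    have "E * 11 \<le> E * exp (5 / 2)" using exp_five_halves E by (intro mult_left_mono) auto
    also have "\<dots> \<le> 1" using Rt T_pos by (simp add: E5)
    finally show ?thesis by simp
  qed
  have e1: "eps * Lt * T\<^sup>2 \<le> 5 / 64 * (K * T\<^sup>2) * (E * E)"
  proof -
    \<comment> \<open>As 7/6 \<ge> 1, the square root is at least 1, and replacing it by 1 can only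
      enlarge the bound on \<open>eps * Lt\<close>.\<close>
    have "0 \<le> 3 / (2 * K * T\<^sup>2)" using K_pos by simp
    then have "1 \<le> sqrt (7 / 6 + 3 / (2 * K * T\<^sup>2))" unfolding real_sqrt_ge_1_iff by linarith
    then have "5 / 64 * K / sqrt (7 / 6 + 3 / (2 * K * T\<^sup>2)) \<le> 5 / 64 * K / 1"
      using K_pos by (intro divide_left_mono) auto
    then have "5 / 64 * K / sqrt (7 / 6 + 3 / (2 * K * T\<^sup>2)) * (E * E) \<le> 5 / 64 * K * (E * E)"
      using E by (intro mult_right_mono) auto
    then have "eps * Lt \<le> 5 / 64 * K * (E * E)" using epsLt unfolding EE Rt_def by linarith
    from mult_right_mono[OF this, of "T\<^sup>2"] show ?thesis by (simp add: mult_ac)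
  qed
  have "E * E \<le> 1 / 11 * (1 / 11)" using E E_le by (intro mult_mono) auto
  from mult_left_mono[OF this KT(2)] e1 have e1': "eps * Lt * T\<^sup>2 \<le> K * T\<^sup>2 / 1000"
    using KT(2) by simp
  have small: "(L + eps * Lt) * T\<^sup>2 \<le> 4 / 25" using gam(1) e1' KT by (simp add: distrib_right)
  have lip: "norm (gradV x - gradV y) \<le> L * norm (x - y)"
    "norm (grad1W x y - grad1W x' y') \<le> Lt * (norm (x - x') + norm (y - y'))" for x y x' y'
    using V_lip W_lip by blast+
  interpret coupled_mean_field_flows gradV grad1W L Lt T eps mu mu' Q P Q' P' pi
    by (intro coupled_mean_field_flows.intro mean_field_flow.intro coupled_mean_field_flows_axioms.intro)
      (rule lip integrable_norm_of_second_moment[OF mu] integrable_norm_of_second_moment[OF mu'] | fact)+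
  define I where "I = (\<integral>z. norm (fst z - snd z) \<partial>pi)"
  define F where "F = (\<lambda>z :: 'a \<times> 'a. fdist R T (norm (fst z - snd z)))"
  obtain D where D0: "0 \<le> D" and D: "\<And>t. t \<in> {0..T} \<Longrightarrow> disp t \<le> D" and DI: "D \<le> 6 / 5 * I"
  proof -
    have "eps * Lt * T\<^sup>2 \<le> 1 / 50" using e1' gam(1) KT by simp
    from disp_le_initial[OF this] show ?thesis using that unfolding I_def by blast
  qed
  define d where "d = 2 * (eps * Lt * D * T\<^sup>2)"
  define c where "c = 1 - 9 / 25 * (K * T\<^sup>2) * E"
  have d0: "0 \<le> d" using eps_nn Lt_nn D0 by (simp add: d_def)
  have step: "(\<integral>\<^sup>+ xi. \<integral>\<^sup>+ u. ennreal (rho R T (Q T x xi) (Q' T x' (coup_eta Rt g x x' xi u))) \<partial>unif01 \<partial>std_normal_vec)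
      \<le> ennreal (c * F (x, x') + d)" for x x'
  proof -
    define r where "r = norm (x - x')"
    have r: "0 \<le> r" "fdist R T r \<le> r" using fdist_le[OF _ T_pos R0] by (simp_all add: r_def)
    have Fr: "9 / 25 * (K * T\<^sup>2) * E * fdist R T r \<le> 9 / 25 * (K * T\<^sup>2) * r * E"
      using mult_left_mono[OF r(2), of "9 / 25 * (K * T\<^sup>2) * E"] KT E by (simp add: mult_ac)
    have cF: "c * fdist R T r = fdist R T r - 9 / 25 * (K * T\<^sup>2) * E * fdist R T r"
      by (simp add: c_def left_diff_distrib)
    show ?thesis
    proof (cases "r < Rt")
      case True
      \<comment> \<open>\<open>K * T\<^sup>2\<close> is at most a quarter of
        \<open>L * T\<^sup>2\<close>, hence at most 3/80 of \<open>g * T\<close>; the rate for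
        distant points therefore serves for close ones as well.\<close>
      have "9 / 25 * (K * T\<^sup>2) \<le> 9 / 50 * (g * T)" using gam(5) KT by linarith
      then have "9 / 25 * (K * T\<^sup>2) * r * E \<le> 9 / 50 * (g * T) * r * E"
        using r(1) E by (intro mult_right_mono) auto
      with Fr d0 have "fdist R T r - 9 / 50 * (g * T) * r * E + 11 / 20 * (eps * Lt * D * T\<^sup>2) \<le> c * fdist R T r + d"
        unfolding cF d_def by linarith
      with coupling_step_near[OF D gam(2,3,4,5) _ R_eq, of x x'] True gam(5) KT e1' show ?thesis
        unfolding F_def fst_conv snd_conv r_def E_def by (auto intro: order_trans ennreal_leI)
    next
      case False
      have "fdist R T r - 9 / 25 * (K * T\<^sup>2) * r * E + 2 * (eps * Lt * D * T\<^sup>2) \<le> c * fdist R T r + d"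
        using Fr unfolding cF d_def by linarith
      with coupling_step_far[OF D K_pos KL gam(1) e1' conv Rt R0, of x x'] False show ?thesis
        unfolding F_def fst_conv snd_conv r_def E_def by (auto intro: order_trans ennreal_leI)
    qed
  qed
  have iz: "integrable pi (\<lambda>z. norm (fst z - snd z))" by (rule integrable_pi_dist)
  have [measurable]: "(\<lambda>z. norm (fst z - snd z)) \<in> borel_measurable pi" using iz by auto
  have F0: "0 \<le> F z" for z using fdist_nonneg[OF _ T_pos] by (simp add: F_def)
  have F_meas: "F \<in> borel_measurable pi"
    unfolding F_def by (rule measurable_compose[OF _ borel_measurable_fdist[OF T_pos]]) measurable
  have iF: "integrable pi F"
  proof (rule Bochner_Integration.integrable_bound[OF iz F_meas])
    show "AE z in pi. norm (F z) \<le> norm (norm (fst z - snd z))"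
      using F0 fdist_le[OF _ T_pos R0] by (auto simp: F_def)
  qed
  define J where "J = (\<integral>z. F z \<partial>pi)"
  have J0: "0 \<le> J" using F0 by (simp add: J_def)
  \<comment> \<open>Passing from the mean distance to the mean of f costs one factor
    \<open>E\<close>; the bound \<open>e1\<close> contains two.\<close>
  have IJ: "E * I \<le> J"
  proof -
    have "(\<integral>z. E * norm (fst z - snd z) \<partial>pi) \<le> J"
      unfolding J_def
    proof (rule integral_mono[OF integrable_mult_right[OF iz] iF])
      fix z :: "'a \<times> 'a"
      have "E * norm (fst z - snd z) \<le> exp (- min R (norm (fst z - snd z)) / T) * norm (fst z - snd z)"
        using T_pos by (intro mult_right_mono) (auto simp: E_def intro!: divide_right_mono)
      also have "\<dots> \<le> F z" unfolding F_def by (rule fdist_ge[OF _ T_pos]) simp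
      finally show "E * norm (fst z - snd z) \<le> F z" .
    qed
    then show ?thesis by (simp add: I_def)
  qed
  have c0: "0 \<le> c"
  proof -
    have "(K * T\<^sup>2) * E \<le> 3 / 80 * (1 / 11)" using KT gam(1) E E_le by (intro mult_mono) auto
    then show ?thesis by (simp add: c_def)
  qed
  \<comment> \<open>In units of \<open>K * T\<^sup>2 * E * J\<close> the contraction is 9/25, the
    mean-field error 2 * 5/64 * 6/5 = 3/16, and the claimed rate at most 16/156 = 4/39; indeed 9/25
    - 3/16 > 4/39.\<close>
  have total: "c * J + d \<le> (1 - K * T\<^sup>2 / 156 * exp (- 5 * Rt / (4 * T))) * J"
  proof -
    have "d \<le> 2 * (5 / 64 * (K * T\<^sup>2) * (E * E)) * D"
      using mult_right_mono[OF e1 D0] by (simp add: d_def mult_ac)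
    also have "\<dots> \<le> 2 * (5 / 64 * (K * T\<^sup>2) * (E * E)) * (6 / 5 * I)"
      using KT E by (intro mult_left_mono DI) auto
    also have "\<dots> = 3 / 16 * (K * T\<^sup>2 * E) * (E * I)" by (simp add: mult_ac)
    also have "\<dots> \<le> 3 / 16 * (K * T\<^sup>2 * E) * J"
      using KT E by (intro mult_left_mono IJ) auto
    finally have d: "d \<le> 3 / 16 * (K * T\<^sup>2 * E * J)" by simp
    have "exp (- 5 * Rt / (4 * T)) \<le> E * 16"
      unfolding E5[symmetric] using exp_five_halves E by (intro mult_left_mono) auto
    then have "K * T\<^sup>2 / 156 * exp (- 5 * Rt / (4 * T)) * J \<le> K * T\<^sup>2 / 156 * (E * 16) * J"
      using KT J0 by (intro mult_right_mono mult_left_mono) auto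
    also have "\<dots> = 4 / 39 * (K * T\<^sup>2 * E * J)" by simp
    finally have "K * T\<^sup>2 / 156 * exp (- 5 * Rt / (4 * T)) * J \<le> 4 / 39 * (K * T\<^sup>2 * E * J)" .
    moreover have "0 \<le> K * T\<^sup>2 * E * J" using KT E J0 by auto
    moreover have "c * J = J - 9 / 25 * (K * T\<^sup>2 * E * J)" by (simp add: c_def left_diff_distrib)
    ultimately show ?thesis using d by (simp only: left_diff_distrib)
  qed
  have U: "prob_space unif01" by (rule prob_space_unif01)
  have "(\<integral>\<^sup>+ \<omega>. ennreal (case \<omega> of ((x, x'), (xi, u)) \<Rightarrow> rho R T (Q T x xi) (Q' T x' (coup_eta Rt g x x' xi u)))
        \<partial>(pi \<Otimes>\<^sub>M (std_normal_vec \<Otimes>\<^sub>M unif01)))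
      \<le> (\<integral>\<^sup>+ z. \<integral>\<^sup>+ y. ennreal (case (z, y) of ((x, x'), (xi, u)) \<Rightarrow>
          rho R T (Q T x xi) (Q' T x' (coup_eta Rt g x x' xi u))) \<partial>(std_normal_vec \<Otimes>\<^sub>M unif01) \<partial>pi)"
    by (intro nn_integral_pair_le prob_space_imp_sigma_finite prob_space_pair prob_space_std_normal_vec U)
  also have "\<dots> \<le> (\<integral>\<^sup>+ z. ennreal (c * F z + d) \<partial>pi)"
  proof (rule nn_integral_mono)
    fix z :: "'a \<times> 'a"
    obtain x x' where z: "z = (x, x')" by (cases z)
    have "(\<integral>\<^sup>+ y. ennreal (case (z, y) of ((x, x'), (xi, u)) \<Rightarrow>
          rho R T (Q T x xi) (Q' T x' (coup_eta Rt g x x' xi u))) \<partial>(std_normal_vec \<Otimes>\<^sub>M unif01))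
        \<le> (\<integral>\<^sup>+ xi. \<integral>\<^sup>+ u. ennreal (case (z, (xi, u)) of ((x, x'), (xi, u)) \<Rightarrow>
          rho R T (Q T x xi) (Q' T x' (coup_eta Rt g x x' xi u))) \<partial>unif01 \<partial>std_normal_vec)"
      by (intro nn_integral_pair_le prob_space_imp_sigma_finite U)
    also have "\<dots> \<le> ennreal (c * F z + d)" using step[of x x'] by (simp add: z)
    finally show "(\<integral>\<^sup>+ y. ennreal (case (z, y) of ((x, x'), (xi, u)) \<Rightarrow>
          rho R T (Q T x xi) (Q' T x' (coup_eta Rt g x x' xi u))) \<partial>(std_normal_vec \<Otimes>\<^sub>M unif01))
        \<le> ennreal (c * F z + d)" .
  qed
  also have "\<dots> = ennreal (\<integral>z. c * F z + d \<partial>pi)"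
    using iF c0 F0 d0 by (intro nn_integral_eq_integral) auto
  also have "(\<integral>z. c * F z + d \<partial>pi) = c * J + d" using iF by (simp add: J_def pi.prob_space)
  also have "ennreal (c * J + d) \<le> ennreal ((1 - K * T\<^sup>2 / 156 * exp (- 5 * Rt / (4 * T))) * J)"
    by (rule ennreal_leI[OF total])
  also have "\<dots> = ennreal (1 - K * T\<^sup>2 / 156 * exp (- 5 * Rt / (4 * T))) * ennreal J"
    using J0 by (rule ennreal_mult'')
  also have "ennreal J = (\<integral>\<^sup>+ z. ennreal (rho R T (fst z) (snd z)) \<partial>pi)"
    unfolding J_def rho_def
    using nn_integral_eq_integral[OF iF] F0 by (simp add: F_def)
  finally show ?thesis by (simp only: Rt_def R_def g_def)
qed

end
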